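(* Consider $\mathsf{Broadcast}$ algorithms that must work on every network of maximum degree at most $\Delta$ (in particular on every complete bipartite graph $K_{2,k}$ with $1\le k\le\Delta$, with the source being one of the two vertices of the size-2 side). Then: (i) in the deterministic $\mathsf{No}\text{-}\mathsf{CD}$ model, any such algorithm requires $\Omega(\Delta)$ energy; (ii) in the randomized $\mathsf{No}\text{-}\mathsf{CD}$ model, any such algorithm succeeding with high probability requires $\Omega(\log\Delta\log n)$ energy; (iii) in the randomized $\mathsf{CD}$ model, any such algorithm succeeding with high probability requires $\Omega(\log n)$ energy.
   Context: Radio network model: the network is a connected undirected graph $G=(V,E)$ with $n=|V|$ vertices and maximum degree $\Delta$; vertices know $n$ and $\Delta$ but not the topology. Time is divided into synchronized slots; in each slot a vertex transmits, listens, or is idle. Transmitting or listening costs one unit of energy, idling is free; the energy of an algorithm is the maximum over vertices of the number of slots in which the vertex transmits or listens. A listener with exactly one transmitting neighbor receives that neighbor's message. In $\mathsf{No}\text{-}\mathsf{CD}$, if zero or at least two neighbors transmit, the listener hears silence. In $\mathsf{CD}$, if zero neighbors transmit the listener hears silence, and if at least two transmit it hears a distinct "noise" signal. Transmitters receive no feedback. In the deterministic setting vertices have distinct IDs in $\{1,\ldots,N\}$; in the randomized setting they have private random bits, and "with high probability" means with failure probability at most $1/\mathrm{poly}(n)$. In $\mathsf{Broadcast}$, a source vertex holds a message $m$ and all vertices must learn $m$. *)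

theory Defs
  imports "HOL-Probability.Probability"
begin

datatype 'msg action = Idle | Listen | Transmit (msg_of: 'msg)

datatype 'msg feedback = NoFeedback | Silence | Noise | Received 'msg

definition is_transmit :: "'msg action \<Rightarrow> bool" where
  "is_transmit a \<longleftrightarrow> (\<exists>x. a = Transmit x)"

definition slot_feedback ::
  "bool \<Rightarrow> 'v set \<Rightarrow> ('v \<Rightarrow> 'v \<Rightarrow> bool) \<Rightarrow> ('v \<Rightarrow> 'msg action) \<Rightarrow> 'v \<Rightarrow> 'msg feedback" where
  "slot_feedback cd V adj a v =
     (if a v = Listen then
        (if (\<exists>!u. u \<in> V \<and> adj v u \<and> is_transmit (a u))
         then Received (msg_of (a (THE u. u \<in> V \<and> adj v u \<and> is_transmit (a u))))
         else if cd \<and> (\<exists>u. u \<in> V \<and> adj v u \<and> is_transmit (a u)) then Noise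
         else Silence)
      else NoFeedback)"

text \<open>A (distributed) algorithm is given by an action function \<open>act\<close>: the action of a vertex
  in a slot depends only on its local data \<open>loc v\<close> (ID or private random bits, and whether it
  is the source together with the message) and on the feedback it has received so far.
  \<open>history \<dots> t v\<close> is the feedback list of vertex v in slots 0..t-1.\<close>
primrec history ::
  "bool \<Rightarrow> 'v set \<Rightarrow> ('v \<Rightarrow> 'v \<Rightarrow> bool) \<Rightarrow> ('v \<Rightarrow> 'l) \<Rightarrow> ('l \<Rightarrow> 'msg feedback list \<Rightarrow> 'msg action)
   \<Rightarrow> nat \<Rightarrow> 'v \<Rightarrow> 'msg feedback list" where
  "history cd V adj loc act 0 = (\<lambda>v. [])"
| "history cd V adj loc act (Suc t) =
     (let H = history cd V adj loc act t
      in (\<lambda>v. H v @ [slot_feedback cd V adj (\<lambda>u. act (loc u) (H u)) v]))"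

definition action_at where
  "action_at cd V adj loc act t v = act (loc v) (history cd V adj loc act t v)"

definition energy_of where
  "energy_of cd V adj loc act T v = card {t. t < T \<and> action_at cd V adj loc act t v \<noteq> Idle}"

definition energy_within where
  "energy_within cd V adj loc act T E \<longleftrightarrow> (\<forall>v\<in>V. energy_of cd V adj loc act T v \<le> E)"

definition broadcast_success where
  "broadcast_success cd V adj loc act outp T m \<longleftrightarrow>
     (\<forall>v\<in>V. outp (loc v) (history cd V adj loc act T v) = m)"

definition K2_verts :: "nat \<Rightarrow> nat set" where
  "K2_verts k = {..k+1}"

definition K2_adj :: "nat \<Rightarrow> nat \<Rightarrow> nat \<Rightarrow> bool" where
  "K2_adj k u v \<longleftrightarrow> (u \<le> 1 \<and> 2 \<le> v \<and> v \<le> k+1) \<or> (v \<le> 1 \<and> 2 \<le> u \<and> u \<le> k+1)"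

definition src_in :: "nat \<Rightarrow> nat \<Rightarrow> nat option" where
  "src_in m v = (if v = 0 then Some m else None)"

definition det_K2_correct ::
  "bool \<Rightarrow> nat \<Rightarrow> nat \<Rightarrow> (nat \<times> nat option \<Rightarrow> 'msg feedback list \<Rightarrow> 'msg action)
   \<Rightarrow> (nat \<times> nat option \<Rightarrow> 'msg feedback list \<Rightarrow> nat) \<Rightarrow> nat \<Rightarrow> bool" where
  "det_K2_correct cd N \<Delta> act outp T \<longleftrightarrow>
     (\<forall>k\<in>{1..\<Delta>}. \<forall>id. inj_on id (K2_verts k) \<and> id ` K2_verts k \<subseteq> {1..N} \<longrightarrow>
        (\<forall>m. broadcast_success cd (K2_verts k) (K2_adj k) (\<lambda>v. (id v, src_in m v)) act outp T m))"

definition det_K2_energy ::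
  "bool \<Rightarrow> nat \<Rightarrow> nat \<Rightarrow> (nat \<times> nat option \<Rightarrow> 'msg feedback list \<Rightarrow> 'msg action) \<Rightarrow> nat \<Rightarrow> nat \<Rightarrow> bool" where
  "det_K2_energy cd N \<Delta> act T E \<longleftrightarrow>
     (\<forall>k\<in>{1..\<Delta>}. \<forall>id. inj_on id (K2_verts k) \<and> id ` K2_verts k \<subseteq> {1..N} \<longrightarrow>
        (\<forall>m. energy_within cd (K2_verts k) (K2_adj k) (\<lambda>v. (id v, src_in m v)) act T E))"

text \<open>\<open>\<omega> v i\<close> is the i-th private random bit of vertex v; all bits independent and fair.\<close>
definition coin_space :: "(nat \<Rightarrow> nat \<Rightarrow> bool) measure" where
  "coin_space = (\<Pi>\<^sub>M v\<in>UNIV. \<Pi>\<^sub>M i\<in>UNIV. measure_pmf (pmf_of_set (UNIV :: bool set)))"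

text \<open>Success with probability at least 1 - n^(-c) (inner measure: the success event contains
  a measurable event of that probability), for every k and every message.\<close>
definition rand_K2_whp ::
  "bool \<Rightarrow> nat \<Rightarrow> real \<Rightarrow> nat \<Rightarrow> ((nat \<Rightarrow> bool) \<times> nat option \<Rightarrow> 'msg feedback list \<Rightarrow> 'msg action)
   \<Rightarrow> ((nat \<Rightarrow> bool) \<times> nat option \<Rightarrow> 'msg feedback list \<Rightarrow> nat) \<Rightarrow> nat \<Rightarrow> bool" where
  "rand_K2_whp cd n c \<Delta> act outp T \<longleftrightarrow>
     (\<forall>k\<in>{1..\<Delta>}. \<forall>m. \<exists>S\<in>sets coin_space.
        S \<subseteq> {\<omega>. broadcast_success cd (K2_verts k) (K2_adj k) (\<lambda>v. (\<omega> v, src_in m v)) act outp T m}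
        \<and> measure coin_space S \<ge> 1 - 1 / (real n powr c))"

definition rand_K2_energy ::
  "bool \<Rightarrow> nat \<Rightarrow> ((nat \<Rightarrow> bool) \<times> nat option \<Rightarrow> 'msg feedback list \<Rightarrow> 'msg action) \<Rightarrow> nat \<Rightarrow> nat \<Rightarrow> bool" where
  "rand_K2_energy cd \<Delta> act T E \<longleftrightarrow>
     (\<forall>k\<in>{1..\<Delta>}. \<forall>m \<omega>. energy_within cd (K2_verts k) (K2_adj k) (\<lambda>v. (\<omega> v, src_in m v)) act T E)"

end

theory Submission
  imports Defs
begin

text \<open>
  In \<open>K\<^bsub>2,k\<^esub>\<close> call the source and the other vertex of the small side hubs, the rest leaves. As long as no
  slot in which a hub listens has exactly one transmitting leaf, the hubs learn nothing but silence
  and noise, so the second hub cannot output the message. The hubs listen in at most \<open>2E\<close> slots.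

  Deterministic, no collision detection: while some listening slot has exactly one transmitter among
  the current leaves, delete that leaf. This takes at most one deletion per slot, so some leaf survives
  unless there are \<open>\<Delta>\<close> listening slots.

  Collision detection: take \<open>k = 2\<close>. Each listening slot splits the possible random strings of a leaf
  into two classes; two strings that always fall into the larger class cause only silence and noise.

  Randomized, no collision detection: take \<open>k = 2K\<close> and let \<open>U\<close> be the set of listening slots in which at
  least one of \<open>K\<close> independent leaves would transmit during a silent run. If the two halves of the leaves
  produce the same set \<open>U\<close>, no slot has exactly one transmitter. This collision has probability at least
  \<open>exp (- H U)\<close>, and by subadditivity \<open>H U\<close> is at most the sum of \<open>h ((1 - p)^K)\<close> over the listening slots,
  where \<open>p\<close> is the probability that a leaf transmits in the slot. For a fixed slot, the sum of these terms
  over all \<open>K = 2^i\<close> is bounded, so for some of the \<open>log \<Delta>\<close> scales the entropy is \<open>O(E / log \<Delta>)\<close>.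
\<close>

section \<open>Executions on complete bipartite graphs\<close>

text \<open>The graph is complete bipartite, so the neighbourhood of a vertex depends only on its
  side. Replacing \<open>K2_adj\<close> by an explicit opposite side makes feedback in different
  graphs and at different vertices comparable.\<close>

lemma slot_feedback_hub:
  assumes "v \<le> 1"
  shows "slot_feedback cd (K2_verts k) (K2_adj k) \<alpha> v = slot_feedback cd {2..k+1} (\<lambda>_ _. True) \<alpha> v"
proof -
  have "(u \<in> K2_verts k \<and> K2_adj k v u \<and> is_transmit (\<alpha> u)) = (u \<in> {2..k+1} \<and> True \<and> is_transmit (\<alpha> u))"
    for u using assms by (auto simp: K2_verts_def K2_adj_def)
  thus ?thesis unfolding slot_feedback_def by presburger
qed

lemma slot_feedback_leaf:
  assumes "v \<in> {2..k+1}"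
  shows "slot_feedback cd (K2_verts k) (K2_adj k) \<alpha> v = slot_feedback cd {0, 1} (\<lambda>_ _. True) \<alpha> v"
proof -
  have "(u \<in> K2_verts k \<and> K2_adj k v u \<and> is_transmit (\<alpha> u)) = (u \<in> {0, 1} \<and> True \<and> is_transmit (\<alpha> u))"
    for u using assms by (auto simp: K2_verts_def K2_adj_def)
  thus ?thesis unfolding slot_feedback_def by presburger
qed

lemma slot_feedback_cong:
  assumes "\<And>u. u \<in> V \<Longrightarrow> \<alpha> u = \<beta> u" and "\<alpha> v = \<beta> w"
  shows "slot_feedback cd V (\<lambda>_ _. True) \<alpha> v = slot_feedback cd V (\<lambda>_ _. True) \<beta> w"
proof -
  have eq: "(u \<in> V \<and> True \<and> is_transmit (\<alpha> u)) = (u \<in> V \<and> True \<and> is_transmit (\<beta> u))" for u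
    using assms(1) by auto
  have "\<alpha> (THE u. u \<in> V \<and> True \<and> is_transmit (\<beta> u)) = \<beta> (THE u. u \<in> V \<and> True \<and> is_transmit (\<beta> u))"
    if "\<exists>!u. u \<in> V \<and> True \<and> is_transmit (\<beta> u)"
    using theI'[OF that] assms(1) by blast
  thus ?thesis unfolding slot_feedback_def eq assms(2) by simp
qed

lemma slot_feedback_no_single:
  assumes "\<nexists>!u. u \<in> V \<and> is_transmit (\<alpha> u)"
  shows "slot_feedback cd V (\<lambda>_ _. True) \<alpha> v =
    (if \<alpha> v = Listen then if cd \<and> (\<exists>u\<in>V. is_transmit (\<alpha> u)) then Noise else Silence else NoFeedback)"
  using assms unfolding slot_feedback_def by auto

text \<open>Both leaves carry the same local data \<open>x\<close> and hence act alike, so the hubs never receive a message.\<close>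
definition twin_run ::
  "bool \<Rightarrow> ('l \<Rightarrow> 'msg feedback list \<Rightarrow> 'msg action) \<Rightarrow> 'l \<Rightarrow> 'l \<Rightarrow> 'l \<Rightarrow> nat \<Rightarrow> nat \<Rightarrow> 'msg feedback list" where
  "twin_run cd act a b x =
     history cd (K2_verts 2) (K2_adj 2) (\<lambda>v. if v = 0 then a else if v = 1 then b else x) act"

definition twin_transmits ::
  "bool \<Rightarrow> ('l \<Rightarrow> 'msg feedback list \<Rightarrow> 'msg action) \<Rightarrow> 'l \<Rightarrow> 'l \<Rightarrow> 'l \<Rightarrow> nat \<Rightarrow> bool" where
  "twin_transmits cd act a b x t \<longleftrightarrow> is_transmit (act x (twin_run cd act a b x t 2))"

lemma twin_run_0 [simp]: "twin_run cd act a b x 0 v = []"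
  by (simp add: twin_run_def)

lemma twin_run_leaf_Suc:
  assumes "v \<in> {2, 3}"
  shows "twin_run cd act a b x (Suc t) v = twin_run cd act a b x t v @
    [slot_feedback cd {0, 1} (\<lambda>_ _. True)
      (\<lambda>u. act (if u = 0 then a else if u = 1 then b else x) (twin_run cd act a b x t u)) v]"
proof -
  have "v \<in> {2..2+1}" using assms by auto
  thus ?thesis by (simp add: twin_run_def Let_def slot_feedback_leaf del: One_nat_def)
qed

lemma twin_run_leaves_eq: "twin_run cd act a b x t 3 = twin_run cd act a b x t 2"
proof (induction t)
  case (Suc t)
  show ?case unfolding twin_run_leaf_Suc[of 2, simplified] twin_run_leaf_Suc[of 3, simplified] Suc
    by (auto intro!: slot_feedback_cong simp: Suc)
qed simp

text \<open>\<open>{2..2+1}\<close> is the leaf range \<open>{2..k+1}\<close> at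
  \<open>k = 2\<close>, kept in the shape of the general lemmas.\<close>

lemma no_unique_if_both:
  assumes "P (3::nat) = P 2"
  shows "\<nexists>!u. u \<in> {2..2+1} \<and> P u"
proof
  assume "\<exists>!u. u \<in> {2..2+1} \<and> P u"
  then obtain u where u: "u \<in> {2..2+1} \<and> P u" and uniq: "\<forall>w. w \<in> {2..2+1} \<and> P w \<longrightarrow> w = u"
    by (rule ex1E)
  have "u = 2 \<or> u = 3" using u by auto
  hence P: "P 2" "P 3" using u assms by auto
  have "2 = u" using uniq[rule_format, of 2] P by simp
  moreover have "3 = u" using uniq[rule_format, of 3] P by simp
  ultimately show False by simp
qed

text \<open>Twins give zero or two transmitters, so all that a listening hub can learn is the bit
  \<open>twin_transmits\<close>, and that only with collision detection.\<close>

lemma twin_run_hub_Suc: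
  assumes "v = 0 \<and> l = a \<or> v = 1 \<and> l = b"
  shows "twin_run cd act a b x (Suc t) v = twin_run cd act a b x t v @
    [if act l (twin_run cd act a b x t v) = Listen
     then if cd \<and> twin_transmits cd act a b x t then Noise else Silence else NoFeedback]"
proof -
  let ?f = "\<lambda>u. act (if u = 0 then a else if u = 1 then b else x) (twin_run cd act a b x t u)"
  have leaf: "is_transmit (?f u) = twin_transmits cd act a b x t" if "u \<in> {2..2+1}" for u
  proof -
    have "u = 2 \<or> u = 3" using that by auto
    thus ?thesis by (auto simp: twin_run_leaves_eq twin_transmits_def)
  qed
  have ns: "\<nexists>!u. u \<in> {2..2+1} \<and> is_transmit (?f u)"
    by (rule no_unique_if_both) (simp add: twin_run_leaves_eq)
  have ex: "(\<exists>u\<in>{2..2+1}. is_transmit (?f u)) = twin_transmits cd act a b x t"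
  proof -
    have "(\<exists>u\<in>{2..2+1}. is_transmit (?f u)) = (\<exists>u\<in>{2..2+1::nat}. twin_transmits cd act a b x t)"
      by (rule bex_cong[OF refl leaf])
    also have "\<dots> = twin_transmits cd act a b x t" by (auto intro: bexI[of _ 2])
    finally show ?thesis .
  qed
  have v: "v \<le> 1" "?f v = act l (twin_run cd act a b x t v)" using assms by auto
  have "twin_run cd act a b x (Suc t) v = twin_run cd act a b x t v @
      [slot_feedback cd (K2_verts 2) (K2_adj 2) ?f v]"
    by (simp add: twin_run_def Let_def)
  thus ?thesis
    unfolding slot_feedback_hub[OF v(1)] slot_feedback_no_single[OF ns] ex v(2) .
qed

text \<open>A leaf hears only the hubs. If the hubs have the histories \<open>h0\<close> and
  \<open>h1\<close> both in the real run and in the twin runs of all leaves, a leaf cannot tell the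
  real run from its own twin run. In turn, without a lone transmitter the hubs get the feedback of
  the twin runs. Both directions go through one induction on time.\<close>

lemma history_eq_twin_run:
  fixes l :: "nat \<Rightarrow> 'l" and act :: "'l \<Rightarrow> 'msg feedback list \<Rightarrow> 'msg action"
  assumes k: "1 \<le> k"
    and h: "\<And>v t. v \<in> {2..k+1} \<Longrightarrow> t \<le> T \<Longrightarrow>
        twin_run cd act (l 0) (l 1) (l v) t 0 = h0 t \<and> twin_run cd act (l 0) (l 1) (l v) t 1 = h1 t"
    and no_single: "\<And>t. t < T \<Longrightarrow> act (l 0) (h0 t) = Listen \<or> act (l 1) (h1 t) = Listen \<Longrightarrow>
        \<nexists>!v. v \<in> {2..k+1} \<and> twin_transmits cd act (l 0) (l 1) (l v) t"
    and "t \<le> T"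
  shows "history cd (K2_verts k) (K2_adj k) l act t 0 = h0 t \<and>
         history cd (K2_verts k) (K2_adj k) l act t 1 = h1 t \<and>
         (\<forall>v\<in>{2..k+1}. history cd (K2_verts k) (K2_adj k) l act t v = twin_run cd act (l 0) (l 1) (l v) t 2)"
  using \<open>t \<le> T\<close>
proof (induction t)
  case 0
  thus ?case using h[of 2 0] k by auto
next
  case (Suc t)
  let ?H = "history cd (K2_verts k) (K2_adj k) l act"
  let ?f = "\<lambda>u. act (l u) (?H t u)"
  let ?tr = "\<lambda>v. twin_transmits cd act (l 0) (l 1) (l v) t"
  have t: "t < T" "t \<le> T" "Suc t \<le> T" using Suc.prems by auto
  have IH: "?H t 0 = h0 t" "?H t 1 = h1 t"
    "\<And>v. v \<in> {2..k+1} \<Longrightarrow> ?H t v = twin_run cd act (l 0) (l 1) (l v) t 2"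
    using Suc.IH t by blast+
  have tr: "is_transmit (?f v) = ?tr v" if "v \<in> {2..k+1}" for v
    using IH(3)[OF that] by (simp add: twin_transmits_def)
  have two: "2 \<in> {2..k+1}" using k by auto
  have step: "?H (Suc t) v = ?H t v @ [slot_feedback cd (K2_verts k) (K2_adj k) ?f v]" for v
    by (simp add: Let_def)
  have hubs: "slot_feedback cd (K2_verts k) (K2_adj k) ?f w =
      (if act (l w) (hw t) = Listen then if cd \<and> ?tr 2 then Noise else Silence else NoFeedback)"
    if w: "w = 0 \<and> hw = h0 \<or> w = 1 \<and> hw = h1" for w hw
  proof (cases "act (l w) (hw t) = Listen")
    case False
    thus ?thesis using w IH(1,2) by (auto simp: slot_feedback_def)
  next
    case True
    have "(v \<in> {2..k+1} \<and> is_transmit (?f v)) = (v \<in> {2..k+1} \<and> ?tr v)" for v using tr by blast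
    moreover have "\<nexists>!v. v \<in> {2..k+1} \<and> ?tr v" using no_single[OF t(1)] True w by blast
    ultimately have ns: "\<nexists>!v. v \<in> {2..k+1} \<and> is_transmit (?f v)" by presburger
    \<comment> \<open>With collision detection the entry that a listening hub adds in slot
      \<open>t\<close> reveals the transmission bit. The histories agree up to \<open>Suc t\<close>,
      so all leaves share this bit and real noise matches noise in the twin runs.\<close>
    have all_eq: "?tr v = ?tr 2" if v: "v \<in> {2..k+1}" and cd for v
    proof -
      have "twin_run cd act (l 0) (l 1) (l v) (Suc t) w = twin_run cd act (l 0) (l 1) (l 2) (Suc t) w"
        "twin_run cd act (l 0) (l 1) (l v) t w = hw t" "twin_run cd act (l 0) (l 1) (l 2) t w = hw t"
        using h[OF v t(3)] h[OF two t(3)] h[OF v t(2)] h[OF two t(2)] w by auto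
      thus ?thesis using True \<open>cd\<close> w
        twin_run_hub_Suc[of w "l w" "l 0" "l 1" cd act "l v" t]
        twin_run_hub_Suc[of w "l w" "l 0" "l 1" cd act "l 2" t]
        by (auto split: if_splits)
    qed
    have "slot_feedback cd (K2_verts k) (K2_adj k) ?f w =
      (if ?f w = Listen then if cd \<and> (\<exists>u\<in>{2..k+1}. is_transmit (?f u)) then Noise else Silence else NoFeedback)"
      using w by (subst slot_feedback_hub) (auto simp only: slot_feedback_no_single[OF ns])
    moreover have "(cd \<and> (\<exists>u\<in>{2..k+1}. is_transmit (?f u))) = (cd \<and> ?tr 2)"
      using all_eq tr two by blast
    moreover have "?f w = act (l w) (hw t)" using w IH(1,2) by auto
    ultimately show ?thesis by presburger
  qed
  have h0: "h0 (Suc t) = h0 t @ [if act (l 0) (h0 t) = Listen then if cd \<and> ?tr 2 then Noise else Silence else NoFeedback]"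
    using twin_run_hub_Suc[of 0 "l 0" "l 0" "l 1" cd act "l 2" t] h[OF two t(3)] h[OF two t(2)] by auto
  have h1: "h1 (Suc t) = h1 t @ [if act (l 1) (h1 t) = Listen then if cd \<and> ?tr 2 then Noise else Silence else NoFeedback]"
    using twin_run_hub_Suc[of 1 "l 1" "l 0" "l 1" cd act "l 2" t] h[OF two t(3)] h[OF two t(2)] by auto
  have leaf: "?H (Suc t) v = twin_run cd act (l 0) (l 1) (l v) (Suc t) 2" if v: "v \<in> {2..k+1}" for v
  proof -
    have "slot_feedback cd {0, 1} (\<lambda>_ _. True) ?f v = slot_feedback cd {0, 1} (\<lambda>_ _. True)
      (\<lambda>u. act (if u = 0 then l 0 else if u = 1 then l 1 else l v) (twin_run cd act (l 0) (l 1) (l v) t u)) 2"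
      using IH h[OF v t(2)] v by (intro slot_feedback_cong) auto
    moreover have "2 \<in> {2, 3::nat}" by simp
    ultimately show ?thesis by (simp only: step slot_feedback_leaf[OF v] IH(3)[OF v] twin_run_leaf_Suc)
  qed
  have "?H (Suc t) 0 = h0 (Suc t)" "?H (Suc t) 1 = h1 (Suc t)"
    using hubs[of 0 h0] hubs[of 1 h1] by (simp_all only: step IH(1,2) h0 h1 simp_thms)
  thus ?case using leaf by blast
qed

section \<open>Silent runs without collision detection\<close>

primrec silent_history ::
  "('l \<Rightarrow> 'msg feedback list \<Rightarrow> 'msg action) \<Rightarrow> 'l \<Rightarrow> nat \<Rightarrow> 'msg feedback list" where
  "silent_history act a 0 = []"
| "silent_history act a (Suc t) = silent_history act a t @
     [if act a (silent_history act a t) = Listen then Silence else NoFeedback]"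

text \<open>Zero and two transmitters sound alike, so the history of a hub depends on its own data
  alone. Hence every choice of leaf data meets the common-history hypothesis of
  \<open>history_eq_twin_run\<close>.\<close>

lemma twin_run_no_cd:
  "twin_run False act a b x t 0 = silent_history act a t"
  "twin_run False act a b x t 1 = silent_history act b t"
proof (induction t)
  case (Suc t)
  case 1 show ?case using Suc twin_run_hub_Suc[of 0 a a b False act x t] by simp
next
  case (Suc t)
  case 2 show ?case using Suc twin_run_hub_Suc[of 1 b a b False act x t] by simp
qed simp_all

definition silent_listening ::
  "('l \<Rightarrow> 'msg feedback list \<Rightarrow> 'msg action) \<Rightarrow> 'l \<Rightarrow> 'l \<Rightarrow> nat \<Rightarrow> nat set" where
  "silent_listening act a b T =
     {t. t < T \<and> (act a (silent_history act a t) = Listen \<or> act b (silent_history act b t) = Listen)}"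

lemma finite_silent_listening [simp]: "finite (silent_listening act a b T)"
  by (simp add: silent_listening_def)

lemma history_eq_silent:
  assumes "1 \<le> k"
    and "\<And>t. t \<in> silent_listening act (l 0) (l 1) T \<Longrightarrow>
        \<nexists>!v. v \<in> {2..k+1} \<and> twin_transmits False act (l 0) (l 1) (l v) t"
    and "t \<le> T"
  shows "history False (K2_verts k) (K2_adj k) l act t 0 = silent_history act (l 0) t"
    and "history False (K2_verts k) (K2_adj k) l act t 1 = silent_history act (l 1) t"
  using history_eq_twin_run[of k T False act l "silent_history act (l 0)" "silent_history act (l 1)" t]
    assms twin_run_no_cd[of act "l 0" "l 1"] by (auto simp: silent_listening_def)

text \<open>There are two hubs, each spending at most \<open>E\<close>. The slots in
  \<open>L\<close> must be listening slots of a real execution, because only there is energy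
  bounded.\<close>

lemma card_hub_listening_le:
  assumes "energy_within cd (K2_verts k) (K2_adj k) l act T E"
    and "\<And>t. t \<in> L \<Longrightarrow> t < T \<and> (action_at cd (K2_verts k) (K2_adj k) l act t 0 = Listen
          \<or> action_at cd (K2_verts k) (K2_adj k) l act t 1 = Listen)"
  shows "card L \<le> 2 * E"
proof -
  let ?A = "\<lambda>v. {t. t < T \<and> action_at cd (K2_verts k) (K2_adj k) l act t v \<noteq> Idle}"
  have "L \<subseteq> ?A 0 \<union> ?A 1" using assms(2) by fastforce
  hence "card L \<le> card (?A 0 \<union> ?A 1)" by (intro card_mono) auto
  also have "\<dots> \<le> card (?A 0) + card (?A 1)" by (rule card_Un_le)
  also have "\<dots> \<le> E + E" using assms(1)
    unfolding energy_within_def energy_of_def by (intro add_mono) (auto simp: K2_verts_def)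
  finally show ?thesis by simp
qed

section \<open>Deterministic algorithms\<close>

text \<open>Delete, one after the other, elements that are alone in some \<open>F t\<close>: each \<open>t\<close> causes at most
  one deletion.\<close>
lemma exists_subset_without_singles:
  assumes "finite L" "finite P" "card L < card P"
  shows "\<exists>G\<subseteq>P. G \<noteq> {} \<and> (\<forall>t\<in>L. \<nexists>!x. x \<in> G \<and> F t x)"
  using assms
proof (induction "card L" arbitrary: L P)
  case 0
  thus ?case by (intro exI[of _ P]) auto
next
  case (Suc n)
  show ?case
  proof (cases "\<forall>t\<in>L. \<nexists>!x. x \<in> P \<and> F t x")
    case True
    thus ?thesis using Suc.prems by (intro exI[of _ P]) auto
  next
    case False
    then obtain t x where t: "t \<in> L" "x \<in> P" and x: "\<And>y. y \<in> P \<Longrightarrow> F t y \<Longrightarrow> y = x" by blast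
    have "card (L - {t}) < card (P - {x})" using t Suc.prems Suc.hyps(2) by simp
    moreover have "n = card (L - {t})" using t Suc.prems Suc.hyps(2) by simp
    ultimately obtain G where G: "G \<subseteq> P - {x}" "G \<noteq> {}" "\<forall>t'\<in>L - {t}. \<nexists>!x. x \<in> G \<and> F t' x"
      using Suc.hyps(1)[of "L - {t}" "P - {x}"] Suc.prems by auto
    have "\<nexists>!y. y \<in> G \<and> F t y" using x G(1) by blast
    thus ?thesis using G by (intro exI[of _ G]) blast
  qed
qed

text \<open>While fewer than \<open>\<Delta>\<close> listening slots occur, some leaf set lets the
  hubs hear only silence; at time \<open>T\<close> this would contradict correctness. The slots are
  counted in a hypothetical silent run, whereas \<open>E\<close> bounds real runs, so the count
  stops at the first time \<open>S\<close> where it reaches \<open>\<Delta>\<close>.\<close>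

lemma deterministic_energy_bound:
  fixes act :: "nat \<times> nat option \<Rightarrow> 'msg feedback list \<Rightarrow> 'msg action"
  assumes \<Delta>: "1 \<le> \<Delta>" "\<Delta> + 2 \<le> N"
    and correct: "det_K2_correct False N \<Delta> act outp T"
    and energy: "det_K2_energy False N \<Delta> act T E"
  shows "\<Delta> \<le> 2 * E"
proof -
  define b where "b = (2::nat, None :: nat option)"
  \<comment> \<open>Diagonal choice: \<open>b\<close> does not contain the message, so the output of
    the second hub after a silent run is known before \<open>m\<close> is fixed.\<close>
  define m where "m = Suc (outp b (silent_history act b T))"
  define a where "a = (1::nat, Some m)"
  define L where "L = silent_listening act a b"
  \<comment> \<open>The horizon \<open>S\<close> stays free: it becomes \<open>T\<close> for the
    contradiction with correctness, and the last time with fewer than \<open>\<Delta>\<close> slots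
    for the energy count.\<close>
  have run: "\<exists>k id. k \<in> {1..\<Delta>} \<and> inj_on id (K2_verts k) \<and> id ` K2_verts k \<subseteq> {1..N} \<and>
      (\<forall>t\<le>S. history False (K2_verts k) (K2_adj k) (\<lambda>v. (id v, src_in m v)) act t 0 = silent_history act a t \<and>
             history False (K2_verts k) (K2_adj k) (\<lambda>v. (id v, src_in m v)) act t 1 = silent_history act b t) \<and>
      id 0 = 1 \<and> id 1 = 2"
    if S: "card (L S) < \<Delta>" for S
  proof -
    have "finite (L S)" by (simp add: L_def)
    then obtain G where G: "G \<subseteq> {3..\<Delta>+2}" "G \<noteq> {}"
      "\<forall>t\<in>L S. \<nexists>!x. x \<in> G \<and> twin_transmits False act a b (x, None) t"
      using exists_subset_without_singles[of "L S" "{3..\<Delta>+2}" "\<lambda>t x. twin_transmits False act a b (x, None) t"] S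
      by auto
    have fin: "finite G" using G(1) finite_subset by blast
    define k where "k = card G"
    have "card {2..k+1} = card G" by (simp add: k_def)
    then obtain f where f: "bij_betw f {2..k+1} G"
      using fin by (metis finite_atLeastAtMost finite_same_card_bij)
    define id' where "id' v = (if v \<le> 1 then v + 1 else f v)" for v
    have k: "1 \<le> k" "k \<le> \<Delta>" using G(1,2) fin card_mono[OF _ G(1)]
      by (auto simp: k_def card_gt_0_iff Suc_le_eq)
    have fG: "f v \<in> {3..\<Delta>+2}" if "v \<in> {2..k+1}" for v using bij_betw_apply[OF f that] G(1) by blast
    have inj: "inj_on id' (K2_verts k)"
    proof (rule inj_onI)
      fix v w assume vw: "v \<in> K2_verts k" "w \<in> K2_verts k" "id' v = id' w"
      show "v = w"
      proof (cases "v \<le> 1 \<or> w \<le> 1")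
        case True
        thus ?thesis using vw fG[of v] fG[of w] by (auto simp: id'_def K2_verts_def split: if_splits)
      next
        case False
        thus ?thesis using vw inj_onD[OF bij_betw_imp_inj_on[OF f], of v w] by (auto simp: id'_def K2_verts_def)
      qed
    qed
    have ran: "id' ` K2_verts k \<subseteq> {1..N}"
    proof
      fix y assume "y \<in> id' ` K2_verts k"
      then obtain v where v: "v \<le> k + 1" "y = id' v" by (auto simp: K2_verts_def)
      show "y \<in> {1..N}" using v fG[of v] \<Delta> by (cases "v \<le> 1") (auto simp: id'_def)
    qed
    let ?l = "\<lambda>v. (id' v, src_in m v)"
    have l: "?l 0 = a" "?l 1 = b" by (auto simp: id'_def a_def b_def src_in_def)
    have "\<nexists>!v. v \<in> {2..k+1} \<and> twin_transmits False act a b (?l v) t" if t: "t \<in> L S" for t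
    proof
      assume "\<exists>!v. v \<in> {2..k+1} \<and> twin_transmits False act a b (?l v) t"
      then obtain v where v: "v \<in> {2..k+1}" "twin_transmits False act a b (?l v) t"
        and uniq: "\<And>w. w \<in> {2..k+1} \<Longrightarrow> twin_transmits False act a b (?l w) t \<Longrightarrow> w = v" by blast
      have lf: "?l w = (f w, None)" if "w \<in> {2..k+1}" for w
        using that by (auto simp: id'_def src_in_def)
      have "\<exists>!x. x \<in> G \<and> twin_transmits False act a b (x, None) t"
      proof (rule ex1I[of _ "f v"])
        show "f v \<in> G \<and> twin_transmits False act a b (f v, None) t"
          using v lf f by (auto simp: bij_betw_def)
      next
        fix x assume x: "x \<in> G \<and> twin_transmits False act a b (x, None) t"
        then obtain w where "w \<in> {2..k+1}" "x = f w" using f by (auto simp: bij_betw_def)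
        thus "x = f v" using uniq[of w] lf[of w] x by simp
      qed
      thus False using G(3) t by blast
    qed
    hence "\<forall>t\<le>S. history False (K2_verts k) (K2_adj k) ?l act t 0 = silent_history act a t \<and>
             history False (K2_verts k) (K2_adj k) ?l act t 1 = silent_history act b t"
      using history_eq_silent[of k act ?l S, unfolded l] k unfolding L_def by blast
    moreover have "id' 0 = 1" "id' 1 = 2" by (auto simp: id'_def)
    ultimately show ?thesis using k inj ran by (intro exI[of _ k] exI[of _ id']) auto
  qed
  have big: "\<Delta> \<le> card (L T)"
  proof (rule ccontr)
    assume "\<not> \<Delta> \<le> card (L T)"
    then obtain k id where ki: "k \<in> {1..\<Delta>}" "inj_on id (K2_verts k)" "id ` K2_verts k \<subseteq> {1..N}"
      "history False (K2_verts k) (K2_adj k) (\<lambda>v. (id v, src_in m v)) act T 1 = silent_history act b T"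
      "id 1 = 2"
      using run[of T] by auto
    have "outp (id 1, src_in m 1) (history False (K2_verts k) (K2_adj k) (\<lambda>v. (id v, src_in m v)) act T 1) = m"
      using correct ki(1-3) unfolding det_K2_correct_def broadcast_success_def
      by (auto simp: K2_verts_def)
    thus False using ki(4,5) by (simp add: m_def b_def src_in_def)
  qed
  define S where "S = (LEAST S. \<Delta> \<le> card (L S))"
  have S1: "\<Delta> \<le> card (L S)" unfolding S_def by (rule LeastI) (rule big)
  have S2: "S \<le> T" unfolding S_def by (rule Least_le) (rule big)
  have "S \<noteq> 0" using S1 \<Delta> by (cases S) (auto simp: L_def silent_listening_def)
  then obtain S' where S': "S = Suc S'" by (cases S) auto
  \<comment> \<open>Silent histories up to time \<open>S'\<close> already fix the actions in slot
    \<open>S'\<close>, so every slot counted in \<open>L (Suc S')\<close> occurs in this one real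
    network.\<close>
  have "card (L S') < \<Delta>" using not_less_Least[of S' "\<lambda>S. \<Delta> \<le> card (L S)"] S' by (auto simp: S_def)
  then obtain k id where ki: "k \<in> {1..\<Delta>}" "inj_on id (K2_verts k)" "id ` K2_verts k \<subseteq> {1..N}"
    and hist: "\<And>t. t \<le> S' \<Longrightarrow> history False (K2_verts k) (K2_adj k) (\<lambda>v. (id v, src_in m v)) act t 0 = silent_history act a t \<and>
             history False (K2_verts k) (K2_adj k) (\<lambda>v. (id v, src_in m v)) act t 1 = silent_history act b t"
    and i: "id 0 = 1" "id 1 = 2"
    using run[of S'] by blast
  have "energy_within False (K2_verts k) (K2_adj k) (\<lambda>v. (id v, src_in m v)) act T E"
    using energy ki unfolding det_K2_energy_def by blast
  hence "card (L S) \<le> 2 * E"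
  proof (rule card_hub_listening_le)
    fix t assume "t \<in> L S"
    hence "t \<le> S'" "t < T" "act a (silent_history act a t) = Listen \<or> act b (silent_history act b t) = Listen"
      using S' S2 by (auto simp: L_def silent_listening_def)
    thus "t < T \<and> (action_at False (K2_verts k) (K2_adj k) (\<lambda>v. (id v, src_in m v)) act t 0 = Listen \<or>
             action_at False (K2_verts k) (K2_adj k) (\<lambda>v. (id v, src_in m v)) act t 1 = Listen)"
      using hist[of t] i by (simp add: action_at_def a_def b_def src_in_def)
  qed
  thus ?thesis using S1 by simp
qed

section \<open>Fixing the random bits\<close>

lemma prob_space_coin_space: "prob_space coin_space"
  unfolding coin_space_def by (intro prob_space_PiM measure_pmf.prob_space_axioms)

lemma space_coin_space [simp]: "space coin_space = UNIV"
  unfolding coin_space_def by (simp add: space_PiM)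

text \<open>The coin rows of different vertices are independent with the same law, so picking rows
  along an injection preserves the measure.\<close>

lemma coin_space_reindex:
  assumes "inj g" and S: "S \<in> sets coin_space"
  shows "{\<omega>. \<omega> \<circ> g \<in> S} \<in> sets coin_space"
    and "measure coin_space {\<omega>. \<omega> \<circ> g \<in> S} = measure coin_space S"
proof -
  define B :: "(nat \<Rightarrow> bool) measure" where "B = (\<Pi>\<^sub>M i\<in>UNIV. measure_pmf (pmf_of_set UNIV))"
  have coin: "coin_space = (\<Pi>\<^sub>M v\<in>UNIV. B)" by (simp add: coin_space_def B_def)
  have "prob_space B" unfolding B_def by (intro prob_space_PiM measure_pmf.prob_space_axioms)
  hence distr: "distr coin_space coin_space (\<lambda>\<omega>. \<omega> \<circ> g) = coin_space"
    using distr_PiM_reindex[of UNIV "\<lambda>_. B" g UNIV] assms(1) unfolding coin by (simp add: comp_def restrict_def)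
  have meas: "(\<lambda>\<omega>. \<omega> \<circ> g) \<in> measurable coin_space coin_space"
    unfolding coin comp_def by (rule measurable_PiM_single') (auto simp: space_PiM)
  show "{\<omega>. \<omega> \<circ> g \<in> S} \<in> sets coin_space"
    using measurable_sets[OF meas S] by (simp add: vimage_def)
  show "measure coin_space {\<omega>. \<omega> \<circ> g \<in> S} = measure coin_space S"
    using measure_distr[OF meas S] by (simp add: distr vimage_def)
qed

text \<open>Averaging over injective renamings \<open>g i\<close> of the vertices fixes one outcome for all random
  bits; afterwards only finite counting is needed, so no measurability of the algorithm enters.\<close>
lemma exists_coins_averaging:
  fixes w :: "'i \<Rightarrow> real" and g :: "'i \<Rightarrow> nat \<Rightarrow> nat"
  assumes "finite I"
    and "\<And>i. i \<in> I \<Longrightarrow> inj (g i)"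
    and "\<And>i. i \<in> I \<Longrightarrow> S i \<in> sets coin_space"
    and "\<And>i. i \<in> I \<Longrightarrow> measure coin_space (S i) \<ge> 1 - \<delta>"
    and "\<And>i. i \<in> I \<Longrightarrow> 0 \<le> w i"
  shows "\<exists>\<omega>. (\<Sum>i\<in>I. w i * of_bool (\<omega> \<circ> g i \<notin> S i)) \<le> \<delta> * (\<Sum>i\<in>I. w i)"
proof (rule ccontr)
  interpret prob_space coin_space by (rule prob_space_coin_space)
  let ?A = "\<lambda>i. {\<omega>. \<omega> \<circ> g i \<in> S i}"
  let ?f = "\<lambda>\<omega>. \<Sum>i\<in>I. w i * indicator (- ?A i) \<omega>"
  have A: "- ?A i \<in> sets coin_space" if "i \<in> I" for i
    using coin_space_reindex(1)[of "g i" "S i"] assms(2,3) that sets.compl_sets[of "?A i" coin_space]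
    by (simp add: Compl_eq_Diff_UNIV)
  have prob: "measure coin_space (- ?A i) \<le> \<delta>" if "i \<in> I" for i
    using prob_compl[of "?A i"] coin_space_reindex[of "g i" "S i"] assms(2-4)[OF that]
    by (simp add: Compl_eq_Diff_UNIV)
  assume "\<nexists>\<omega>. (\<Sum>i\<in>I. w i * of_bool (\<omega> \<circ> g i \<notin> S i)) \<le> \<delta> * (\<Sum>i\<in>I. w i)"
  hence large: "?f \<omega> > \<delta> * (\<Sum>i\<in>I. w i)" for \<omega>
    by (simp add: indicator_def not_le of_bool_def if_distrib cong: if_cong)
  have "integrable coin_space ?f"
    using A by (intro Bochner_Integration.integrable_sum integrable_mult_right integrable_real_indicator)
      (auto simp: emeasure_eq_measure)
  hence "\<delta> * (\<Sum>i\<in>I. w i) < expectation ?f"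
    using large by (intro expectation_greater) auto
  also have "expectation ?f = (\<Sum>i\<in>I. w i * measure coin_space (- ?A i))"
    using A by (subst Bochner_Integration.integral_sum)
      (auto intro!: integrable_mult_right integrable_real_indicator simp: emeasure_eq_measure)
  also have "\<dots> \<le> (\<Sum>i\<in>I. w i * \<delta>)"
    using prob assms(5) by (intro sum_mono mult_left_mono) auto
  finally show False by (simp add: sum_distrib_left mult.commute)
qed

section \<open>Collision detection\<close>

lemma twin_run_hub_outcomes:
  "length (twin_run cd act a b x t 1) = t \<and> set (twin_run cd act a b x t 1) \<subseteq> {NoFeedback, Silence, Noise}"
proof (induction t)
  case (Suc t)
  thus ?case using twin_run_hub_Suc[of 1 b a b cd act x t] by auto
qed simp

lemma twin_transmits_determined:
  assumes "v = 0 \<and> l = a \<or> v = 1 \<and> l = b"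
    and "twin_run True act a b x (Suc t) v = twin_run True act a b y (Suc t) v"
    and "act l (twin_run True act a b x t v) = Listen"
  shows "twin_transmits True act a b x t = twin_transmits True act a b y t"
  using assms(2,3) unfolding twin_run_hub_Suc[OF assms(1)] by (auto split: if_splits)

text \<open>Whenever a hub listens, keep the larger one of the two classes of leaves that transmit or
  do not transmit in that slot.\<close>
lemma exists_indistinguishable_leaves:
  assumes "finite A0"
  shows "\<exists>A\<subseteq>A0. \<exists>h0 h1.
    card A0 \<le> card A * 2 ^ card {t. t < T \<and> (act a (h0 t) = Listen \<or> act b (h1 t) = Listen)} \<and>
    (\<forall>v\<in>A. \<forall>t\<le>T. twin_run cd act a b (X v) t 0 = h0 t \<and> twin_run cd act a b (X v) t 1 = h1 t)"
proof (induction T)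
  case 0
  show ?case by (intro exI[of _ A0] exI[of _ "\<lambda>_. []"] conjI) auto
next
  case (Suc T)
  then obtain A h0 h1 where A: "A \<subseteq> A0"
    and card: "card A0 \<le> card A * 2 ^ card {t. t < T \<and> (act a (h0 t) = Listen \<or> act b (h1 t) = Listen)}"
    and h: "\<And>v t. v \<in> A \<Longrightarrow> t \<le> T \<Longrightarrow>
      twin_run cd act a b (X v) t 0 = h0 t \<and> twin_run cd act a b (X v) t 1 = h1 t"
    by blast
  define lis where "lis \<longleftrightarrow> act a (h0 T) = Listen \<or> act b (h1 T) = Listen"
  define P where "P v \<longleftrightarrow> twin_transmits cd act a b (X v) T" for v
  have fin: "finite A" using A assms finite_subset by blast
  \<comment> \<open>Only a listening slot splits the class; \<open>c\<close> is the bit of the half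
    that is kept. In other slots both hubs record \<open>NoFeedback\<close> and the class stays
    whole.\<close>
  have "\<exists>B\<subseteq>A. \<exists>c. (lis \<longrightarrow> (\<forall>v\<in>B. P v = c)) \<and> card A \<le> card B * (if lis then 2 else 1)"
  proof (cases lis)
    case True
    have "card A = card {v\<in>A. P v} + card {v\<in>A. \<not> P v}"
      using fin by (subst card_Un_disjoint[symmetric]) (auto intro: arg_cong[where f = card])
    hence "card A \<le> card {v\<in>A. P v} * 2 \<or> card A \<le> card {v\<in>A. \<not> P v} * 2" by linarith
    thus ?thesis
    proof
      assume "card A \<le> card {v\<in>A. P v} * 2"
      thus ?thesis using True by (intro exI[of _ "{v\<in>A. P v}"] conjI exI[of _ True]) auto
    next
      assume "card A \<le> card {v\<in>A. \<not> P v} * 2"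
      thus ?thesis using True by (intro exI[of _ "{v\<in>A. \<not> P v}"] conjI exI[of _ False]) auto
    qed
  qed auto
  then obtain B c where B: "B \<subseteq> A" "\<And>v. lis \<Longrightarrow> v \<in> B \<Longrightarrow> P v = c"
    and cardB: "card A \<le> card B * (if lis then 2 else 1)" by blast
  define f where "f l hh = hh @ [if act l hh = Listen then if cd \<and> c then Noise else Silence else NoFeedback]"
    for l hh
  define h0' where "h0' t = (if t \<le> T then h0 t else f a (h0 T))" for t
  define h1' where "h1' t = (if t \<le> T then h1 t else f b (h1 T))" for t
  have run: "twin_run cd act a b (X v) t 0 = h0' t \<and> twin_run cd act a b (X v) t 1 = h1' t"
    if v: "v \<in> B" and t: "t \<le> Suc T" for v t
  proof (cases "t \<le> T")
    case True
    thus ?thesis using h v B(1) by (auto simp: h0'_def h1'_def)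
  next
    case False
    hence "t = Suc T" using t by simp
    have "v \<in> A" using v B(1) by auto
    hence e: "twin_run cd act a b (X v) T 0 = h0 T" "twin_run cd act a b (X v) T 1 = h1 T"
      using h by auto
    have "f a (h0 T) = twin_run cd act a b (X v) (Suc T) 0"
      using B(2)[OF _ v] twin_run_hub_Suc[of 0 a a b cd act "X v" T]
      by (simp add: e f_def P_def lis_def)
    moreover have "f b (h1 T) = twin_run cd act a b (X v) (Suc T) 1"
      using B(2)[OF _ v] twin_run_hub_Suc[of 1 b a b cd act "X v" T] unfolding e
      by (simp add: f_def P_def lis_def)
    ultimately show ?thesis using \<open>t = Suc T\<close> by (simp add: h0'_def h1'_def)
  qed
  let ?L = "{t. t < T \<and> (act a (h0 t) = Listen \<or> act b (h1 t) = Listen)}"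
  have "{t. t < Suc T \<and> (act a (h0' t) = Listen \<or> act b (h1' t) = Listen)} = ?L \<union> (if lis then {T} else {})"
    by (auto simp: h0'_def h1'_def lis_def less_Suc_eq)
  hence "card {t. t < Suc T \<and> (act a (h0' t) = Listen \<or> act b (h1' t) = Listen)} = card ?L + (if lis then 1 else 0)"
    by simp
  moreover have "card A0 \<le> card B * (if lis then 2 else 1) * 2 ^ card ?L"
    using card cardB by (meson le_trans mult_le_mono1)
  ultimately have "card A0 \<le> card B * 2 ^ card {t. t < Suc T \<and> (act a (h0' t) = Listen \<or> act b (h1' t) = Listen)}"
    by (cases lis) (simp_all add: mult.assoc)
  moreover have "B \<subseteq> A0" using A B(1) by blast
  ultimately show ?case using run by blast
qed

lemma src_in_simps [simp]: "src_in m 0 = Some m" "v \<noteq> 0 \<Longrightarrow> src_in m v = None"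
  by (simp_all add: src_in_def)

text \<open>A twin run is the real run on \<open>K2_verts 2\<close> for an outcome that gives both
  leaves equal bits. Such outcomes have probability zero, yet \<open>rand_K2_energy\<close> covers
  every outcome.\<close>

lemma energy_within_twin_run:
  assumes "rand_K2_energy cd \<Delta> act T E" "2 \<le> \<Delta>"
  shows "energy_within cd (K2_verts 2) (K2_adj 2)
    (\<lambda>v. if v = 0 then (x0, Some m) else if v = 1 then (x1, None) else (x, None)) act T E"
proof -
  let ?\<omega> = "\<lambda>v. if v = 0 then x0 else if v = 1 then x1 else x"
  have eq: "(\<lambda>v. (?\<omega> v, src_in m v)) =
    (\<lambda>v. if v = 0 then (x0, Some m) else if v = 1 then (x1, None) else (x, None))"
    by (rule ext) simp
  have "2 \<in> {1..\<Delta>}" using assms(2) by simp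
  hence "energy_within cd (K2_verts 2) (K2_adj 2) (\<lambda>v. (?\<omega> v, src_in m v)) act T E"
    using assms(1)[unfolded rand_K2_energy_def, rule_format, of 2 ?\<omega> m] by blast
  thus ?thesis unfolding eq .
qed

lemma card_twin_listening_le:
  assumes "rand_K2_energy cd \<Delta> act T E" "2 \<le> \<Delta>"
    and "a = (x0, Some m)" "b = (x1, None)"
    and "\<And>t. t < T \<Longrightarrow> twin_run cd act a b (x, None) t 0 = h0 t \<and> twin_run cd act a b (x, None) t 1 = h1 t"
  shows "card {t. t < T \<and> (act a (h0 t) = Listen \<or> act b (h1 t) = Listen)} \<le> 2 * E"
proof (rule card_hub_listening_le)
  let ?l = "\<lambda>v::nat. if v = 0 then a else if v = 1 then b else (x, None)"
  show "energy_within cd (K2_verts 2) (K2_adj 2) ?l act T E"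
    using energy_within_twin_run[OF assms(1,2)] unfolding assms(3,4) .
  fix t assume "t \<in> {t. t < T \<and> (act a (h0 t) = Listen \<or> act b (h1 t) = Listen)}"
  hence "t < T" "act a (h0 t) = Listen \<or> act b (h1 t) = Listen" by auto
  moreover have "history cd (K2_verts 2) (K2_adj 2) ?l act t 0 = h0 t"
    "history cd (K2_verts 2) (K2_adj 2) ?l act t 1 = h1 t"
    using assms(5)[OF \<open>t < T\<close>] unfolding twin_run_def by blast+
  ultimately show "t < T \<and> (action_at cd (K2_verts 2) (K2_adj 2) ?l act t 0 = Listen \<or>
      action_at cd (K2_verts 2) (K2_adj 2) ?l act t 1 = Listen)"
    unfolding action_at_def by simp
qed

lemma broadcast_success_hub:
  assumes "broadcast_success cd (K2_verts k) adj l act outp T m"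
  shows "outp (l 1) (history cd (K2_verts k) adj l act T 1) = m"
proof -
  have "1 \<in> K2_verts k" by (simp add: K2_verts_def)
  thus ?thesis using assms unfolding broadcast_success_def by blast
qed

text \<open>Fix the coins of the hubs and sample \<open>M\<close> coin rows for leaves. The hubs
  listen at most \<open>2 * E\<close> times, so at least a fraction \<open>1 / 2 ^ (2 * E)\<close>
  of the rows is indistinguishable, and a pair of leaves falls into this class with probability at
  least \<open>1 / 2 ^ (4 * E)\<close>, up to the diagonal. For most messages such a pair makes the
  second hub fail.\<close>

lemma cd_energy_bound:
  fixes act :: "(nat \<Rightarrow> bool) \<times> nat option \<Rightarrow> 'msg feedback list \<Rightarrow> 'msg action"
  assumes \<Delta>: "2 \<le> \<Delta>"
    and whp: "rand_K2_whp True n c \<Delta> act outp T"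
    and energy: "rand_K2_energy True \<Delta> act T E"
  shows "1 / 2 ^ (4 * E) \<le> 1 / (real n powr c)"
proof -
  define \<delta> where "\<delta> = 1 / (real n powr c)"
  have "\<delta> \<ge> 0" by (simp add: \<delta>_def)
  have "2 \<in> {1..\<Delta>}" using \<Delta> by simp
  hence "\<forall>m. \<exists>S\<in>sets coin_space.
        S \<subseteq> {\<omega>. broadcast_success True (K2_verts 2) (K2_adj 2) (\<lambda>v. (\<omega> v, src_in m v)) act outp T m}
        \<and> measure coin_space S \<ge> 1 - \<delta>"
    using whp unfolding rand_K2_whp_def \<delta>_def by blast
  hence "\<exists>S. \<forall>m. S m \<in> sets coin_space \<and>
        S m \<subseteq> {\<omega>. broadcast_success True (K2_verts 2) (K2_adj 2) (\<lambda>v. (\<omega> v, src_in m v)) act outp T m}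
        \<and> measure coin_space (S m) \<ge> 1 - \<delta>"
    unfolding Bex_def by (rule choice)
  then obtain S where S: "\<And>m. S m \<in> sets coin_space"
    "\<And>m \<omega>. \<omega> \<in> S m \<Longrightarrow> broadcast_success True (K2_verts 2) (K2_adj 2) (\<lambda>v. (\<omega> v, src_in m v)) act outp T m"
    "\<And>m. measure coin_space (S m) \<ge> 1 - \<delta>" by blast
  \<comment> \<open>The first factor loses the messages that are answered correctly, the second the
    pairs with equal entries; both losses vanish as \<open>M\<close> grows.\<close>
  have main: "(1 - 1 / real M) * (1 / 2 ^ (4 * E) - 1 / real M) \<le> \<delta>" if M: "2 ^ (4 * E) \<le> M" for M
  proof -
    have M0: "0 < M" using M by (metis gr_zeroI not_less zero_less_numeral zero_less_power)
    define V where "V = {2..<M+2}"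
    define D where "D = {(p, q). p \<in> V \<and> q \<in> V \<and> p \<noteq> q}"
    \<comment> \<open>A hub has at most \<open>3 ^ T\<close> histories made of the three feedbacks
      other than messages, so at most a fraction \<open>1 / M\<close> of the messages can be
      answered correctly.\<close>
    define Q where "Q = 3 ^ T * M"
    define g where "g p q v = (if v = 2 then p else if v = 3 then q else if v \<le> 1 then v else v + M)"
      for p q v :: nat
    have V: "finite V" "card V = M" by (auto simp: V_def)
    have D: "finite D" "D \<subseteq> V \<times> V" unfolding D_def using V(1)
      by (auto intro: finite_subset[of _ "V \<times> V"])
    have cardD: "card D \<le> M * M" using card_mono[OF _ D(2)] V by (simp add: card_cartesian_product)
    have inj: "inj (g p q)" if "(p, q) \<in> D" for p q
      using that by (auto simp: inj_def g_def D_def V_def)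
    have "\<exists>\<omega>. (\<Sum>i\<in>{..<Q} \<times> D. (1::real) * of_bool (\<omega> \<circ> (\<lambda>(m, p, q). g p q) i \<notin> S (fst i)))
        \<le> \<delta> * (\<Sum>i\<in>{..<Q} \<times> D. 1)"
      using D S inj by (intro exists_coins_averaging) auto
    then obtain \<omega> where "(\<Sum>i\<in>{..<Q} \<times> D. (1::real) * of_bool (\<omega> \<circ> (\<lambda>(m, p, q). g p q) i \<notin> S (fst i)))
        \<le> \<delta> * (\<Sum>i\<in>{..<Q} \<times> D. 1)" by blast
    moreover have "(\<Sum>i\<in>{..<Q} \<times> D. (1::real) * of_bool (\<omega> \<circ> (\<lambda>(m, p, q). g p q) i \<notin> S (fst i))) =
        (\<Sum>m<Q. \<Sum>d\<in>D. of_bool (\<omega> \<circ> g (fst d) (snd d) \<notin> S m))"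
      unfolding sum.cartesian_product by (rule sum.cong) auto
    ultimately have avg: "(\<Sum>m<Q. \<Sum>d\<in>D. of_bool (\<omega> \<circ> g (fst d) (snd d) \<notin> S m)) \<le> \<delta> * (real Q * real (card D))"
      using D(1) by (simp only: sum_constant card_cartesian_product card_lessThan of_nat_mult mult_1_right)
    define a b where "a = (\<lambda>m. (\<omega> 0, Some m :: nat option))" and "b = (\<omega> 1, None :: nat option)"
    define G where "G m A h0 h1 \<longleftrightarrow> A \<subseteq> V \<and>
      M \<le> card A * 2 ^ card {t. t < T \<and> (act (a m) (h0 t) = Listen \<or> act b (h1 t) = Listen)} \<and>
      (\<forall>v\<in>A. \<forall>t\<le>T. twin_run True act (a m) b (\<omega> v, None) t 0 = h0 t \<and>
         twin_run True act (a m) b (\<omega> v, None) t 1 = h1 t)" for m A h0 h1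
    have "\<exists>A h0 h1. G m A h0 h1" for m
      using exists_indistinguishable_leaves[OF V(1), of T act "a m" b True "\<lambda>v. (\<omega> v, None)"]
      unfolding G_def V(2) by blast
    then obtain A h0 h1 where G: "\<And>m. G m (A m) (h0 m) (h1 m)" by metis
    have A: "\<And>m. A m \<subseteq> V"
      and cardA: "\<And>m. M \<le> card (A m) * 2 ^ card {t. t < T \<and> (act (a m) (h0 m t) = Listen \<or> act b (h1 m t) = Listen)}"
      and h: "\<And>m v t. v \<in> A m \<Longrightarrow> t \<le> T \<Longrightarrow> twin_run True act (a m) b (\<omega> v, None) t 0 = h0 m t \<and>
          twin_run True act (a m) b (\<omega> v, None) t 1 = h1 m t"
      using G unfolding G_def by blast+
    have finA: "finite (A m)" for m using A V(1) finite_subset by blast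
    have neA: "A m \<noteq> {}" for m using cardA[of m] M0 by auto
    have cardA': "M \<le> card (A m) * 2 ^ (2 * E)" for m
    proof -
      obtain v where v: "v \<in> A m" using neA by blast
      have "card {t. t < T \<and> (act (a m) (h0 m t) = Listen \<or> act b (h1 m t) = Listen)} \<le> 2 * E"
        by (rule card_twin_listening_le[OF energy \<Delta>, of "a m" "\<omega> 0" m b "\<omega> 1" "\<omega> v"])
          (use h[OF v] in \<open>auto simp: a_def b_def\<close>)
      hence "card (A m) * 2 ^ card {t. t < T \<and> (act (a m) (h0 m t) = Listen \<or> act b (h1 m t) = Listen)}
        \<le> card (A m) * 2 ^ (2 * E)" by (intro mult_le_mono power_increasing) auto
      thus ?thesis using cardA[of m] by linarith
    qed
    \<comment> \<open>The history \<open>h1 m T\<close> may depend on \<open>m\<close> through the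
      source, but on \<open>good\<close> it determines \<open>m\<close>, so counting histories
      bounds \<open>good\<close>.\<close>
    define good where "good = {m. m < Q \<and> outp b (h1 m T) = m}"
    have card_good: "card good \<le> 3 ^ T"
    proof -
      let ?H = "{xs. set xs \<subseteq> {NoFeedback, Silence, Noise :: 'msg feedback} \<and> length xs = T}"
      have fin: "finite ?H" by (rule finite_lists_length_eq) simp
      have "inj_on (\<lambda>m. h1 m T) good" by (rule inj_onI) (auto simp: good_def)
      moreover have "(\<lambda>m. h1 m T) ` good \<subseteq> ?H"
      proof
        fix y assume "y \<in> (\<lambda>m. h1 m T) ` good"
        then obtain m where m: "y = h1 m T" by blast
        obtain v where "v \<in> A m" using neA by blast
        thus "y \<in> ?H" using h[of v m T] m twin_run_hub_outcomes[of True act "a m" b "(\<omega> v, None)" T] by auto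
      qed
      ultimately have "card good \<le> card ?H" using fin by (rule card_inj_on_le)
      also have "card ?H = 3 ^ T" by (subst card_lists_length_eq) (auto simp: numeral_3_eq_3)
      finally show ?thesis .
    qed
    have bad: "real M * real M / 2 ^ (4 * E) - real M \<le> (\<Sum>d\<in>D. of_bool (\<omega> \<circ> g (fst d) (snd d) \<notin> S m))"
      if m: "m \<in> {..<Q} - good" for m
    proof -
      let ?P = "{(p, q). p \<in> A m \<and> q \<in> A m \<and> p \<noteq> q}"
      have fail: "\<omega> \<circ> g p q \<notin> S m" if pq: "(p, q) \<in> ?P" for p q
      proof
        let ?l = "\<lambda>v. ((\<omega> \<circ> g p q) v, src_in m v)"
        assume "\<omega> \<circ> g p q \<in> S m"
        hence "broadcast_success True (K2_verts 2) (K2_adj 2) ?l act outp T m" by (rule S(2))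
        hence out: "outp (?l 1) (history True (K2_verts 2) (K2_adj 2) ?l act T 1) = m"
          by (rule broadcast_success_hub)
        have l: "?l 0 = a m" "?l 1 = b" by (auto simp: g_def a_def b_def)
        have l2: "\<exists>w\<in>A m. ?l v = (\<omega> w, None)" if "v \<in> {2..2+1}" for v
        proof -
          have "v = 2 \<or> v = 3" using that by auto
          thus ?thesis using pq by (auto simp: g_def)
        qed
        have "history True (K2_verts 2) (K2_adj 2) ?l act T 1 = h1 m T"
        proof -
          have hh: "twin_run True act (?l 0) (?l 1) (?l v) t 0 = h0 m t \<and>
             twin_run True act (?l 0) (?l 1) (?l v) t 1 = h1 m t" if v: "v \<in> {2..2+1}" and t: "t \<le> T" for v t
          proof -
            obtain w where "w \<in> A m" "?l v = (\<omega> w, None)" using l2[OF v] by blast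
            thus ?thesis using h[OF _ t] by (simp only: l)
          qed
          \<comment> \<open>While a hub listens, equal histories up to \<open>Suc t\<close> force
            the two leaves to agree, so none or both transmit.\<close>
          have ns: "\<nexists>!v. v \<in> {2..2+1} \<and> twin_transmits True act (?l 0) (?l 1) (?l v) t"
            if t: "t < T" and lis: "act (?l 0) (h0 m t) = Listen \<or> act (?l 1) (h1 m t) = Listen" for t
          proof (rule no_unique_if_both)
            have t': "t \<le> T" "Suc t \<le> T" using t by auto
            have r: "(2::nat) \<in> {2..2+1}" "(3::nat) \<in> {2..2+1}" by auto
            note e = hh[OF r(1) t'(1)] hh[OF r(1) t'(2)] hh[OF r(2) t'(1)] hh[OF r(2) t'(2)]
            from lis show "twin_transmits True act (?l 0) (?l 1) (?l 3) t = twin_transmits True act (?l 0) (?l 1) (?l 2) t"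
            proof
              assume "act (?l 0) (h0 m t) = Listen"
              thus ?thesis using twin_transmits_determined[of 0 "?l 0" "?l 0" "?l 1" act "?l 3" t "?l 2"] e
                by (simp only: simp_thms)
            next
              assume "act (?l 1) (h1 m t) = Listen"
              thus ?thesis using twin_transmits_determined[of 1 "?l 1" "?l 0" "?l 1" act "?l 3" t "?l 2"] e
                by (simp only: simp_thms)
            qed
          qed
          have "(1::nat) \<le> 2" by simp
          from history_eq_twin_run[where l = ?l, OF this hh ns order_refl]
          show ?thesis by blast
        qed
        thus False using out m unfolding l by (simp add: good_def)
      qed
      have "?P = A m \<times> A m - (\<lambda>p. (p, p)) ` A m" by auto
      hence "card ?P = card (A m) * card (A m) - card (A m)"
        using finA[of m] by (simp add: card_Diff_subset card_cartesian_product card_image inj_on_def image_subset_iff)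
      hence "real (card ?P) \<ge> real (card (A m)) * real (card (A m)) - real (card (A m))"
        by (metis diff_le_mono le_add_diff_inverse2 le_square of_nat_diff of_nat_mult order_refl)
      moreover have "real (card (A m)) \<le> real M" using card_mono[OF V(1) A[of m]] V(2) by simp
      moreover have "real M * real M / 2 ^ (4 * E) \<le> real (card (A m)) * real (card (A m))"
      proof -
        have "real M \<le> real (card (A m)) * 2 ^ (2 * E)"
          using cardA'[of m] by (metis of_nat_le_iff of_nat_mult of_nat_numeral of_nat_power)
        hence "real M * real M \<le> (real (card (A m)) * 2 ^ (2 * E)) * (real (card (A m)) * 2 ^ (2 * E))"
          by (intro mult_mono) auto
        also have "\<dots> = real (card (A m)) * real (card (A m)) * 2 ^ (4 * E)"
          by (simp add: power_mult power2_eq_square[symmetric] power_mult_distrib flip: power_mult power_add)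
        finally show ?thesis by (simp add: divide_le_eq)
      qed
      ultimately have "real M * real M / 2 ^ (4 * E) - real M \<le> real (card ?P)" by linarith
      also have "\<dots> = (\<Sum>d\<in>?P. of_bool (\<omega> \<circ> g (fst d) (snd d) \<notin> S m))"
        using fail by (simp add: case_prod_beta)
      also have "\<dots> \<le> (\<Sum>d\<in>D. of_bool (\<omega> \<circ> g (fst d) (snd d) \<notin> S m))"
        using D(1) A[of m] by (intro sum_mono2) (auto simp: D_def)
      finally show ?thesis .
    qed
    let ?x = "real M * real M / 2 ^ (4 * E) - real M"
    \<comment> \<open>Here \<open>2 ^ (4 * E) \<le> M\<close> enters: the bound per message must be
      nonnegative to be multiplied by a lower bound on the number of bad messages.\<close>
    have x0: "?x \<ge> 0"
    proof -
      have "real (2 ^ (4 * E)) \<le> real M" using M of_nat_le_iff by blast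
      hence "real M * 2 ^ (4 * E) \<le> real M * real M" by (intro mult_left_mono) auto
      thus ?thesis by (simp add: le_divide_eq)
    qed
    have "(real Q - 3 ^ T) * ?x \<le> real (card ({..<Q} - good)) * ?x"
    proof (intro mult_right_mono x0)
      have "finite good" "good \<subseteq> {..<Q}" by (auto simp: good_def)
      hence "real (card ({..<Q} - good)) = real Q - real (card good)"
        by (metis card_Diff_subset card_lessThan card_mono finite_lessThan of_nat_diff)
      moreover have "real (card good) \<le> 3 ^ T"
        using card_good by (metis of_nat_le_iff of_nat_numeral of_nat_power)
      ultimately show "real Q - 3 ^ T \<le> real (card ({..<Q} - good))" by linarith
    qed
    also have "\<dots> = (\<Sum>m\<in>{..<Q} - good. ?x)" by simp
    also have "\<dots> \<le> (\<Sum>m\<in>{..<Q} - good. \<Sum>d\<in>D. of_bool (\<omega> \<circ> g (fst d) (snd d) \<notin> S m))"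
      by (rule sum_mono) (rule bad)
    also have "\<dots> \<le> (\<Sum>m<Q. \<Sum>d\<in>D. of_bool (\<omega> \<circ> g (fst d) (snd d) \<notin> S m))"
      by (intro sum_mono2) (auto intro: sum_nonneg)
    also have "\<dots> \<le> \<delta> * (real Q * real (card D))" by (rule avg)
    also have "\<dots> \<le> \<delta> * (real Q * (real M * real M))"
      using \<open>\<delta> \<ge> 0\<close> cardD by (intro mult_left_mono) (auto simp flip: of_nat_mult)
    finally have "(real Q - 3 ^ T) * ?x \<le> \<delta> * (real Q * (real M * real M))" .
    moreover have "(real Q - 3 ^ T) * ?x = (real Q * (real M * real M)) * ((1 - 1 / real M) * (1 / 2 ^ (4 * E) - 1 / real M))"
      using M0 by (simp add: Q_def field_simps)
    moreover have "real Q * (real M * real M) > 0" using M0 by (simp add: Q_def)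
    ultimately show ?thesis
      by (metis (no_types, lifting) mult.commute mult_le_cancel_left_pos)
  qed
  have "(\<lambda>M. (1 - 1 / real M) * (1 / 2 ^ (4 * E) - 1 / real M)) \<longlonglongrightarrow> (1 - 0) * (1 / 2 ^ (4 * E) - 0)"
    by (intro tendsto_intros lim_1_over_n)
  hence "(\<lambda>M. (1 - 1 / real M) * (1 / 2 ^ (4 * E) - 1 / real M)) \<longlonglongrightarrow> 1 / 2 ^ (4 * E)" by simp
  hence "1 / 2 ^ (4 * E) \<le> \<delta>"
    by (rule LIMSEQ_le_const2) (use main in blast)
  thus ?thesis by (simp add: \<delta>_def)
qed

section \<open>Entropy and collisions\<close>

text \<open>It vanishes at \<open>0\<close> and \<open>1\<close>, because \<open>ln 0 = 0\<close>.\<close>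
definition binary_entropy :: "real \<Rightarrow> real" where
  "binary_entropy q = - (q * ln q) - (1 - q) * ln (1 - q)"

section \<open>Dyadic sums of the binary entropy\<close>

text \<open>This is \<open>ln x \<le> x - 1\<close> at the inverse square root of
  \<open>q\<close>.\<close>

lemma neg_mult_ln_le_sqrt:
  assumes "0 \<le> q" "q \<le> 1"
  shows "- (q * ln q) \<le> 2 * (sqrt q - q)"
proof (cases "q = 0")
  case False
  define s where "s = sqrt q"
  have s: "s > 0" "q = s * s" using False assms by (auto simp: s_def)
  have "ln (1 / s) \<le> 1 / s - 1" using s by (intro ln_le_minus_one) auto
  hence "- ln s \<le> 1 / s - 1" using s by (simp add: ln_div)
  hence "2 * (s * s) * (- ln s) \<le> 2 * (s * s) * (1 / s - 1)" using s by (intro mult_left_mono) auto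
  also have "\<dots> = 2 * (s - s * s)" using s by (simp add: field_simps)
  finally show ?thesis using s by (simp add: ln_mult s_def[symmetric])
qed simp

text \<open>The potential \<open>sqrt q - sqrt (1 - q)\<close> drops when \<open>q\<close> is
  squared. With \<open>e = sqrt (1 - q)\<close> the drop is \<open>sqrt q - q\<close>, which pays
  for the term in \<open>ln q\<close>, plus \<open>e * sqrt (1 + q) - e\<close>, which is of order
  \<open>e * q\<close> and pays for the term in \<open>ln (1 - q)\<close>.\<close>

lemma binary_entropy_le_telescoping:
  assumes "0 \<le> q" "q \<le> 1"
  shows "binary_entropy q \<le> 5 * ((sqrt q - sqrt (1 - q)) - (sqrt (q\<^sup>2) - sqrt (1 - q\<^sup>2)))"
proof -
  define e where "e = sqrt (1 - q)"
  have e: "0 \<le> e" "e * e = 1 - q" "e \<le> 1" using assms by (auto simp: e_def)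
  have "q * q \<le> q" using assms by (simp add: mult_left_le)
  hence q: "q \<le> sqrt q" using assms by (intro real_le_rsqrt) (auto simp: power2_eq_square)
  \<comment> \<open>\<open>2/5\<close> is a rational just below \<open>sqrt 2 - 1\<close>, the
    largest slope that works on the whole unit interval. It causes the factor
    \<open>5 = 2 / (2/5)\<close>.\<close>
  have "(1 + 2/5 * q)\<^sup>2 \<le> 1 + q" using \<open>q * q \<le> q\<close> assms by (simp add: power2_eq_square algebra_simps)
  hence "1 + 2/5 * q \<le> sqrt (1 + q)" by (rule real_le_rsqrt)
  hence "e * (1 + 2/5 * q) \<le> e * sqrt (1 + q)" using e by (intro mult_left_mono)
  also have "\<dots> = sqrt (1 - q\<^sup>2)"
    by (simp add: e_def real_sqrt_mult[symmetric] power2_eq_square algebra_simps)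
  finally have 1: "e + 2/5 * (e * q) \<le> sqrt (1 - q\<^sup>2)" by (simp add: algebra_simps)
  have "e * e \<le> e" using mult_left_le[OF e(3,1)] .
  hence "e * (1 - e) \<le> e * q" using e by (intro mult_left_mono) auto
  hence 2: "e - e * e \<le> e * q" by (simp add: algebra_simps)
  have 3: "- (q * ln q) \<le> 2 * (sqrt q - q)" by (rule neg_mult_ln_le_sqrt[OF assms])
  have 4: "- ((1 - q) * ln (1 - q)) \<le> 2 * (e - e * e)"
    using neg_mult_ln_le_sqrt[of "1 - q"] assms e by (simp add: e_def)
  have "sqrt (q\<^sup>2) = q" using assms by simp
  thus ?thesis using 1 2 3 4 q unfolding binary_entropy_def e_def[symmetric] by simp
qed

text \<open>The potential telescopes along repeated squaring and stays between -1 and 1, so it drops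
  by at most 2 in total. That the bound is uniform in the number of scales is the source of the
  factor \<open>log \<Delta>\<close>.\<close>

lemma sum_binary_entropy_dyadic_le:
  assumes "0 \<le> q" "q \<le> 1"
  shows "(\<Sum>i<I. binary_entropy (q ^ 2 ^ i)) \<le> 10"
proof -
  define \<phi> where "\<phi> i = sqrt (q ^ 2 ^ i) - sqrt (1 - q ^ 2 ^ i)" for i :: nat
  have r: "0 \<le> q ^ 2 ^ i" "q ^ 2 ^ i \<le> 1" for i :: nat using assms by (auto simp: power_le_one)
  have "binary_entropy (q ^ 2 ^ i) \<le> 5 * (\<phi> i - \<phi> (Suc i))" for i
  proof -
    have "q ^ 2 ^ Suc i = (q ^ 2 ^ i)\<^sup>2" by (simp add: power_mult[symmetric] mult.commute)
    thus ?thesis using binary_entropy_le_telescoping[OF r(1)[of i] r(2)[of i]] unfolding \<phi>_def by simp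
  qed
  hence "(\<Sum>i<I. binary_entropy (q ^ 2 ^ i)) \<le> (\<Sum>i<I. 5 * (\<phi> i - \<phi> (Suc i)))" by (intro sum_mono)
  also have "\<dots> = 5 * (\<phi> 0 - \<phi> I)" by (simp only: sum_distrib_left[symmetric] sum_lessThan_telescope')
  also have "\<dots> \<le> 10"
  proof -
    have "\<phi> i \<le> 1 \<and> - 1 \<le> \<phi> i" for i
    proof -
      have "sqrt (q ^ 2 ^ i) \<le> 1" "sqrt (1 - q ^ 2 ^ i) \<le> 1" "0 \<le> sqrt (q ^ 2 ^ i)" "0 \<le> sqrt (1 - q ^ 2 ^ i)"
        using r[of i] by auto
      thus ?thesis unfolding \<phi>_def by linarith
    qed
    from this[of 0] this[of I] show ?thesis by simp
  qed
  finally show ?thesis .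
qed

section \<open>Collision probability against entropy\<close>

text \<open>Jensen's inequality for \<open>exp\<close>, by the tangent at the mean \<open>c\<close>.
  It serves twice: over the outcomes in the collision bound and over the scales at the end.\<close>

lemma card_mult_exp_mean_le_sum_exp:
  fixes x :: "'a \<Rightarrow> real"
  assumes "finite A" "A \<noteq> {}"
  shows "real (card A) * exp ((\<Sum>a\<in>A. x a) / real (card A)) \<le> (\<Sum>a\<in>A. exp (x a))"
proof -
  define c where "c = (\<Sum>a\<in>A. x a) / real (card A)"
  have c: "(\<Sum>a\<in>A. x a - c) = 0" using assms by (simp add: sum_subtractf c_def)
  have "exp c * (1 + (x a - c)) \<le> exp (x a)" for a
    using mult_left_mono[OF exp_ge_add_one_self[of "x a - c"], of "exp c"] by (simp add: exp_diff)
  hence "(\<Sum>a\<in>A. exp c * (1 + (x a - c))) \<le> (\<Sum>a\<in>A. exp (x a))" by (rule sum_mono)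
  moreover have "(\<Sum>a\<in>A. exp c * (1 + (x a - c))) = exp c * (real (card A) + (\<Sum>a\<in>A. x a - c))"
    by (simp only: sum_distrib_left[symmetric] sum.distrib) simp
  ultimately show ?thesis unfolding c by (simp add: c_def mult.commute)
qed

text \<open>Cauchy-Schwarz against the product distribution with the same marginals, then Jensen.\<close>
lemma collisions_ge_entropy:
  fixes U :: "'a \<Rightarrow> 'b set"
  assumes \<Omega>: "finite \<Omega>" "\<Omega> \<noteq> {}" and L: "finite L" and U: "\<And>g. g \<in> \<Omega> \<Longrightarrow> U g \<subseteq> L"
    and q: "\<And>j. j \<in> L \<Longrightarrow> q j = real (card {g\<in>\<Omega>. j \<notin> U g}) / real (card \<Omega>)"
  shows "(real (card \<Omega>))\<^sup>2 * exp (- (\<Sum>j\<in>L. binary_entropy (q j)))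
    \<le> real (card {(g, g'). g \<in> \<Omega> \<and> g' \<in> \<Omega> \<and> U g = U g'})"
proof -
  define N where "N = real (card \<Omega>)"
  have N: "N > 0" using \<Omega> by (simp add: N_def card_gt_0_iff)
  define c where "c u = real (card {g\<in>\<Omega>. U g = u})" for u
  \<comment> \<open>The product distribution on subsets of \<open>L\<close> with the marginals of
    \<open>U\<close>.\<close>
  define Q where "Q u = (\<Prod>j\<in>u. 1 - q j) * (\<Prod>j\<in>L - u. q j)" for u
  define x where "x g j = (if j \<in> U g then ln (1 - q j) else ln (q j))" for g j
  have compl: "1 - q j = real (card {g\<in>\<Omega>. j \<in> U g}) / N" if "j \<in> L" for j
  proof -
    have "card \<Omega> = card {g\<in>\<Omega>. j \<in> U g} + card {g\<in>\<Omega>. j \<notin> U g}"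
      using \<Omega>(1) by (subst card_Un_disjoint[symmetric]) (auto intro: arg_cong[where f = card])
    thus ?thesis using N q[OF that] by (simp add: N_def field_simps)
  qed
  have q01: "0 \<le> q j" "q j \<le> 1" if "j \<in> L" for j
    using q[OF that] compl[OF that] N by (auto simp: N_def divide_le_eq card_mono \<Omega>(1))
  have Q0: "0 \<le> Q u" if "u \<in> Pow L" for u
    unfolding Q_def using that q01 by (intro mult_nonneg_nonneg prod_nonneg) auto
  have Q1: "(\<Sum>u\<in>Pow L. Q u) = 1"
    using prod_add[OF L, of "\<lambda>j. 1 - q j" q] by (simp add: Q_def)
  have group: "(\<Sum>u\<in>Pow L. c u * f u) = (\<Sum>g\<in>\<Omega>. f (U g))" for f
  proof -
    have "(\<Sum>u\<in>Pow L. c u * f u) = (\<Sum>u\<in>Pow L. \<Sum>g\<in>{g\<in>\<Omega>. U g = u}. f (U g))"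
      by (intro sum.cong) (auto simp: c_def)
    also have "\<dots> = (\<Sum>g\<in>\<Omega>. f (U g))"
      using \<Omega>(1) L U by (intro sum.group) auto
    finally show ?thesis .
  qed
  have sqrtQ: "sqrt (Q (U g)) = exp (\<Sum>j\<in>L. x g j / 2)" if g: "g \<in> \<Omega>" for g
  proof -
    \<comment> \<open>At an attained set every factor is positive, so the default
      \<open>ln 0 = 0\<close> does not intrude.\<close>
    have pos: "(if j \<in> U g then 1 - q j else q j) = exp (x g j)" if j: "j \<in> L" for j
    proof -
      have "0 < (if j \<in> U g then 1 - q j else q j)"
      proof (cases "j \<in> U g")
        case True
        hence "0 < card {g\<in>\<Omega>. j \<in> U g}" using g \<Omega>(1) by (auto simp: card_gt_0_iff)
        thus ?thesis using True N compl[OF j] by simp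
      next
        case False
        hence "0 < card {g\<in>\<Omega>. j \<notin> U g}" using g \<Omega>(1) by (auto simp: card_gt_0_iff)
        thus ?thesis using False N q[OF j] by (simp add: N_def)
      qed
      thus ?thesis by (auto simp: x_def)
    qed
    have "Q (U g) = (\<Prod>j\<in>L. if j \<in> U g then 1 - q j else q j)"
      using prod.If_cases[OF L, of "\<lambda>j. j \<in> U g" "\<lambda>j. 1 - q j" q] U[OF g]
      by (simp add: Q_def Int_absorb1 Diff_eq)
    also have "\<dots> = exp (\<Sum>j\<in>L. x g j)" using pos L by (simp add: exp_sum)
    also have "\<dots> = (exp (\<Sum>j\<in>L. x g j / 2))\<^sup>2"
      by (simp add: sum_divide_distrib[symmetric] power2_eq_square flip: exp_add)
    finally show ?thesis by simp
  qed
  \<comment> \<open>The mean of the logarithm of \<open>Q (U g)\<close> sees only the marginals and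
    is thus a plain sum of binary entropies. This is where subadditivity of entropy is
    hidden.\<close>
  have "(\<Sum>g\<in>\<Omega>. \<Sum>j\<in>L. x g j / 2) = - (N * (\<Sum>j\<in>L. binary_entropy (q j)) / 2)"
  proof -
    have "(\<Sum>g\<in>\<Omega>. x g j) = - (N * binary_entropy (q j))" if j: "j \<in> L" for j
    proof -
      have "(\<Sum>g\<in>\<Omega>. x g j) = real (card (\<Omega> \<inter> {g. j \<in> U g})) * ln (1 - q j) + real (card (\<Omega> \<inter> - {g. j \<in> U g})) * ln (q j)"
        unfolding x_def sum.If_cases[OF \<Omega>(1)] by simp
      also have "real (card (\<Omega> \<inter> {g. j \<in> U g})) = N * (1 - q j)"
        using N compl[OF j] by (simp add: Int_def)
      also have "real (card (\<Omega> \<inter> - {g. j \<in> U g})) = N * q j"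
        using N q[OF j] by (simp add: Int_def N_def)
      finally show ?thesis by (simp add: binary_entropy_def algebra_simps)
    qed
    thus ?thesis by (subst sum.swap) (simp add: sum_divide_distrib[symmetric] sum_distrib_left sum_negf)
  qed
  hence "N * exp (- ((\<Sum>j\<in>L. binary_entropy (q j)) / 2)) \<le> (\<Sum>g\<in>\<Omega>. exp (\<Sum>j\<in>L. x g j / 2))"
    using card_mult_exp_mean_le_sum_exp[OF \<Omega>, of "\<lambda>g. \<Sum>j\<in>L. x g j / 2"] N by (simp add: N_def)
  also have "\<dots> = (\<Sum>u\<in>Pow L. c u * sqrt (Q u))" unfolding group by (rule sum.cong) (auto simp: sqrtQ)
  finally have "(N * exp (- ((\<Sum>j\<in>L. binary_entropy (q j)) / 2)))\<^sup>2 \<le> (\<Sum>u\<in>Pow L. c u * sqrt (Q u))\<^sup>2"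
    using N by (intro power_mono) auto
  also have "\<dots> \<le> (\<Sum>u\<in>Pow L. (c u)\<^sup>2) * (\<Sum>u\<in>Pow L. (sqrt (Q u))\<^sup>2)" by (rule Cauchy_Schwarz_ineq_sum)
  also have "(\<Sum>u\<in>Pow L. (sqrt (Q u))\<^sup>2) = 1" using Q0 Q1 by simp
  \<comment> \<open>A sum of squared multiplicities counts ordered colliding pairs.\<close>
  also have "(\<Sum>u\<in>Pow L. (c u)\<^sup>2) = (\<Sum>g\<in>\<Omega>. c (U g))"
    using group[of c] by (simp add: power2_eq_square)
  also have "\<dots> = real (card (SIGMA g:\<Omega>. {g'\<in>\<Omega>. U g' = U g}))"
    using \<Omega>(1) by (simp add: c_def)
  also have "(SIGMA g:\<Omega>. {g'\<in>\<Omega>. U g' = U g}) = {(g, g'). g \<in> \<Omega> \<and> g' \<in> \<Omega> \<and> U g = U g'}" by auto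
  finally have "(N * exp (- ((\<Sum>j\<in>L. binary_entropy (q j)) / 2)))\<^sup>2
      \<le> real (card {(g, g'). g \<in> \<Omega> \<and> g' \<in> \<Omega> \<and> U g = U g'})" by simp
  moreover have "(exp (- (h / 2)))\<^sup>2 = exp (- h)" for h :: real
    by (simp add: power2_eq_square flip: exp_add)
  ultimately show ?thesis by (simp only: power_mult_distrib N_def)
qed

section \<open>Collisions between samples with distinct entries\<close>

definition join_tuples :: "nat \<Rightarrow> (nat \<Rightarrow> 'a) \<Rightarrow> (nat \<Rightarrow> 'a) \<Rightarrow> nat \<Rightarrow> 'a" where
  "join_tuples K g g' r = (if r < K then g r else g' (r - K))"

text \<open>Union bound over at most \<open>(2 * K)\<^sup>2\<close> ordered pairs of positions: once
  two positions agree, the entries at all positions but one of them determine the tuple.\<close>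

lemma card_non_injective_pairs_le:
  fixes V :: "'a set"
  assumes V: "finite V" and K: "0 < K"
  shows "card {(g, g'). g \<in> {..<K} \<rightarrow>\<^sub>E V \<and> g' \<in> {..<K} \<rightarrow>\<^sub>E V \<and> \<not> inj_on (join_tuples K g g') {..<2*K}}
    \<le> (2 * K)\<^sup>2 * card V ^ (2 * K - 1)"
proof -
  let ?\<Omega> = "{..<K} \<rightarrow>\<^sub>E V"
  define B where "B p = {(g, g'). g \<in> ?\<Omega> \<and> g' \<in> ?\<Omega> \<and> join_tuples K g g' (fst p) = join_tuples K g g' (snd p)}"
    for p
  define R where "R = {p \<in> {..<2*K} \<times> {..<2*K}. fst p \<noteq> snd p}"
  have fin: "finite ?\<Omega>" using V by (intro finite_PiE) auto
  have cardB: "card (B p) \<le> card V ^ (2 * K - 1)" if p: "p \<in> R" for p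
  proof -
    obtain a b where ab: "p = (a, b)" "a < 2 * K" "b < 2 * K" "a \<noteq> b" using p by (auto simp: R_def)
    define D where "D = {..<2*K} - {b}"
    define F where "F = (\<lambda>(g :: nat \<Rightarrow> 'a, g'). restrict (join_tuples K g g') D)"
    have "inj_on F (B p)"
    proof (rule inj_onI, clarify)
      fix g g' f f' assume gf: "(g, g') \<in> B p" "(f, f') \<in> B p" "F (g, g') = F (f, f')"
      have D: "join_tuples K g g' r = join_tuples K f f' r" if "r \<in> D" for r
        using fun_cong[OF gf(3), of r] that by (simp add: F_def)
      have "a \<in> D" using ab by (simp add: D_def)
      hence "join_tuples K g g' b = join_tuples K f f' b" using D gf(1,2) ab(1) by (simp add: B_def)
      hence all: "join_tuples K g g' r = join_tuples K f f' r" if "r < 2 * K" for r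
        using D[of r] that by (cases "r = b") (auto simp: D_def)
      have "g r = f r" if "r \<in> {..<K}" for r using all[of r] that by (simp add: join_tuples_def)
      moreover have "g' r = f' r" if "r \<in> {..<K}" for r using all[of "r + K"] that by (simp add: join_tuples_def)
      ultimately show "g = f \<and> g' = f'" using gf(1,2) by (auto simp: B_def intro: PiE_ext)
    qed
    moreover have "F ` B p \<subseteq> D \<rightarrow>\<^sub>E V"
    proof (clarify)
      fix g g' assume "(g, g') \<in> B p"
      hence "join_tuples K g g' r \<in> V" if "r \<in> D" for r
        using that by (auto simp: B_def D_def join_tuples_def PiE_def Pi_def)
      thus "F (g, g') \<in> D \<rightarrow>\<^sub>E V" by (auto simp: F_def)
    qed
    moreover have "finite (D \<rightarrow>\<^sub>E V)" using V by (intro finite_PiE) (auto simp: D_def)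
    ultimately have "card (B p) \<le> card (D \<rightarrow>\<^sub>E V)" by (rule card_inj_on_le)
    also have "\<dots> = card V ^ (2 * K - 1)" using ab by (subst card_funcsetE) (auto simp: D_def)
    finally show ?thesis .
  qed
  have finR: "finite R" "card R \<le> (2 * K)\<^sup>2"
  proof -
    have "R \<subseteq> {..<2*K} \<times> {..<2*K}" by (auto simp: R_def)
    thus "finite R" "card R \<le> (2 * K)\<^sup>2"
      using card_mono[of "{..<2*K} \<times> {..<2*K}" R] finite_subset by (auto simp: card_cartesian_product power2_eq_square)
  qed
  have "(\<Sum>p\<in>R. card (B p)) \<le> card R * card V ^ (2 * K - 1)"
    using sum_mono[of R "\<lambda>p. card (B p)" "\<lambda>_. card V ^ (2 * K - 1)"] cardB by simp
  also have "\<dots> \<le> (2 * K)\<^sup>2 * card V ^ (2 * K - 1)" using finR(2) by (rule mult_le_mono1)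
  finally have "(\<Sum>p\<in>R. card (B p)) \<le> (2 * K)\<^sup>2 * card V ^ (2 * K - 1)" .
  moreover have "card {(g, g'). g \<in> ?\<Omega> \<and> g' \<in> ?\<Omega> \<and> \<not> inj_on (join_tuples K g g') {..<2*K}} \<le> card (\<Union>p\<in>R. B p)"
  proof (rule card_mono)
    have "(\<Union>p\<in>R. B p) \<subseteq> ?\<Omega> \<times> ?\<Omega>" by (auto simp: B_def)
    thus "finite (\<Union>p\<in>R. B p)" using fin finite_subset by blast
    show "{(g, g'). g \<in> ?\<Omega> \<and> g' \<in> ?\<Omega> \<and> \<not> inj_on (join_tuples K g g') {..<2*K}} \<subseteq> (\<Union>p\<in>R. B p)"
    proof (clarify)
      fix g g' assume g: "g \<in> ?\<Omega>" "g' \<in> ?\<Omega>" "\<not> inj_on (join_tuples K g g') {..<2*K}"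
      then obtain a b where "a < 2 * K" "b < 2 * K" "a \<noteq> b" "join_tuples K g g' a = join_tuples K g g' b"
        unfolding inj_on_def by blast
      thus "(g, g') \<in> (\<Union>p\<in>R. B p)" using g by (intro UN_I[of "(a, b)"]) (auto simp: R_def B_def)
    qed
  qed
  moreover have "card (\<Union>p\<in>R. B p) \<le> (\<Sum>p\<in>R. card (B p))" using finR(1) by (rule card_UN_le)
  ultimately show ?thesis by linarith
qed

text \<open>Under independent sampling, the probability that all \<open>K\<close> entries avoid
  \<open>j\<close> is the \<open>K\<close>-th power of that for one entry; this feeds
  \<open>collisions_ge_entropy\<close>. Leaves of a network need distinct coin rows, so pairs with a
  repeated entry are subtracted.\<close>

lemma injective_collisions_ge:
  fixes Y :: "'a \<Rightarrow> 'b set"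
  assumes V: "finite V" "V \<noteq> {}" and L: "finite L" and K: "0 < K"
  defines "U \<equiv> \<lambda>g. {j\<in>L. \<exists>r<K. j \<in> Y (g r)}"
  shows "(real (card V)) ^ (2 * K) * (exp (- (\<Sum>j\<in>L. binary_entropy ((real (card {v\<in>V. j \<notin> Y v}) / real (card V)) ^ K)))
            - (2 * real K)\<^sup>2 / real (card V))
    \<le> real (card {(g, g'). g \<in> {..<K} \<rightarrow>\<^sub>E V \<and> g' \<in> {..<K} \<rightarrow>\<^sub>E V \<and> inj_on (join_tuples K g g') {..<2*K} \<and> U g = U g'})"
proof -
  let ?\<Omega> = "{..<K} \<rightarrow>\<^sub>E V"
  let ?H = "\<Sum>j\<in>L. binary_entropy ((real (card {v\<in>V. j \<notin> Y v}) / real (card V)) ^ K)"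
  let ?C = "{(g, g'). g \<in> ?\<Omega> \<and> g' \<in> ?\<Omega> \<and> U g = U g'}"
  let ?B = "{(g, g'). g \<in> ?\<Omega> \<and> g' \<in> ?\<Omega> \<and> \<not> inj_on (join_tuples K g g') {..<2*K}}"
  let ?G = "{(g, g'). g \<in> ?\<Omega> \<and> g' \<in> ?\<Omega> \<and> inj_on (join_tuples K g g') {..<2*K} \<and> U g = U g'}"
  define M where "M = real (card V)"
  have M: "M > 0" using V by (simp add: M_def card_gt_0_iff)
  have fin: "finite ?\<Omega>" using V by (intro finite_PiE) auto
  have ne: "?\<Omega> \<noteq> {}" using V(2) by (simp add: PiE_eq_empty_iff)
  have card\<Omega>: "card ?\<Omega> = card V ^ K" by (subst card_funcsetE) auto
  have "(real (card ?\<Omega>))\<^sup>2 * exp (- ?H) \<le> real (card ?C)"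
  proof (rule collisions_ge_entropy[OF fin ne L])
    show "U g \<subseteq> L" for g by (auto simp: U_def)
    fix j assume j: "j \<in> L"
    have "{g \<in> ?\<Omega>. j \<notin> U g} = {..<K} \<rightarrow>\<^sub>E {v\<in>V. j \<notin> Y v}"
      using j by (auto simp: U_def PiE_def Pi_def)
    hence "card {g \<in> ?\<Omega>. j \<notin> U g} = card {v\<in>V. j \<notin> Y v} ^ K" by (simp add: card_funcsetE)
    thus "(real (card {v\<in>V. j \<notin> Y v}) / real (card V)) ^ K = real (card {g \<in> ?\<Omega>. j \<notin> U g}) / real (card ?\<Omega>)"
      by (simp add: card\<Omega> power_divide)
  qed
  also have "(real (card ?\<Omega>))\<^sup>2 = M ^ (2 * K)"
    by (simp add: card\<Omega> M_def power_mult[symmetric] mult.commute)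
  finally have coll: "M ^ (2 * K) * exp (- ?H) \<le> real (card ?C)" .
  have "real (card ?B) \<le> real ((2 * K)\<^sup>2 * card V ^ (2 * K - 1))"
    using card_non_injective_pairs_le[OF V(1) K] by (simp only: of_nat_le_iff)
  also have "\<dots> = (2 * real K)\<^sup>2 * (M ^ (2 * K) / M)"
  proof -
    have "M ^ (2 * K) = M * M ^ (2 * K - 1)" using K by (simp flip: power_Suc)
    thus ?thesis using M by (simp add: M_def)
  qed
  finally have bad: "real (card ?B) \<le> (2 * real K)\<^sup>2 * (M ^ (2 * K) / M)" .
  have finp: "finite (?\<Omega> \<times> ?\<Omega>)" using fin by simp
  have "finite ?B" "finite ?G" by (rule finite_subset[OF _ finp]; auto)+
  moreover have "?C \<subseteq> ?G \<union> ?B" by auto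
  ultimately have "card ?C \<le> card ?G + card ?B"
    by (meson card_Un_le card_mono finite_UnI le_trans)
  hence "real (card ?C) \<le> real (card ?G) + real (card ?B)" by linarith
  thus ?thesis using coll bad unfolding M_def[symmetric] by (simp add: algebra_simps)
qed

section \<open>No collision detection\<close>

lemma inj_extend_leaf_assignment:
  fixes f :: "nat \<Rightarrow> nat"
  assumes "inj_on f {..<k}" "f ` {..<k} \<subseteq> {2..<M+2}"
  shows "inj (\<lambda>v. if v < 2 then v else if v < k + 2 then f (v - 2) else v + M)"
proof (rule injI)
  fix v w :: nat
  let ?e = "\<lambda>v. if v < 2 then v else if v < k + 2 then f (v - 2) else v + M"
  assume eq: "?e v = ?e w"
  have f: "f (v - 2) \<in> {2..<M+2}" if "\<not> v < 2" "v < k + 2" for v using that assms(2) by (auto simp: image_subset_iff)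
  show "v = w"
  proof (cases "\<not> v < 2 \<and> v < k + 2 \<and> \<not> w < 2 \<and> w < k + 2")
    case True
    hence "v - 2 = w - 2" using inj_onD[OF assms(1), of "v - 2" "w - 2"] eq by auto
    thus ?thesis using True by linarith
  next
    case False
    thus ?thesis using eq f[of v] f[of w] by (auto split: if_splits)
  qed
qed

text \<open>One outcome \<open>\<omega>\<close> is fixed for all scales \<open>i < I\<close>
  together, so the slots \<open>L\<close> and the transmission frequencies \<open>1 - q j\<close>
  are shared by all scales. Each of the at most \<open>2 * E\<close> slots contributes at most 10 to
  the entropies summed over the scales, so their mean is at most \<open>20 * E / I\<close>.\<close>

lemma no_cd_energy_bound:
  fixes act :: "(nat \<Rightarrow> bool) \<times> nat option \<Rightarrow> 'msg feedback list \<Rightarrow> 'msg action"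
  assumes I: "1 \<le> I" "2 ^ I \<le> \<Delta>"
    and whp: "rand_K2_whp False n c \<Delta> act outp T"
    and energy: "rand_K2_energy False \<Delta> act T E"
  shows "exp (- (20 * real E / real I)) \<le> 2 / (real n powr c)"
proof -
  define \<delta> where "\<delta> = 1 / (real n powr c)"
  have \<delta>: "\<delta> \<ge> 0" by (simp add: \<delta>_def)
  have "(2::nat) ^ 1 \<le> 2 ^ I" using I(1) by (intro power_increasing) auto
  hence \<Delta>: "2 \<le> \<Delta>" using I(2) by simp
  have k: "2 * 2 ^ i \<in> {1..\<Delta>}" if "i < I" for i
  proof -
    have "(2::nat) ^ Suc i \<le> 2 ^ I" using that by (intro power_increasing) auto
    thus ?thesis using I(2) by simp
  qed
  have "\<forall>p. \<exists>S. fst p \<in> {1..\<Delta>} \<longrightarrow> S \<in> sets coin_space \<and>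
      S \<subseteq> {\<omega>. broadcast_success False (K2_verts (fst p)) (K2_adj (fst p)) (\<lambda>v. (\<omega> v, src_in (snd p) v)) act outp T (snd p)}
      \<and> measure coin_space S \<ge> 1 - \<delta>"
    using whp unfolding rand_K2_whp_def \<delta>_def by blast
  hence "\<exists>S. \<forall>p. fst p \<in> {1..\<Delta>} \<longrightarrow> S p \<in> sets coin_space \<and>
      S p \<subseteq> {\<omega>. broadcast_success False (K2_verts (fst p)) (K2_adj (fst p)) (\<lambda>v. (\<omega> v, src_in (snd p) v)) act outp T (snd p)}
      \<and> measure coin_space (S p) \<ge> 1 - \<delta>"
    by (rule choice)
  then obtain S0 where S0: "\<And>p. fst p \<in> {1..\<Delta>} \<Longrightarrow> S0 p \<in> sets coin_space \<and>
      S0 p \<subseteq> {\<omega>. broadcast_success False (K2_verts (fst p)) (K2_adj (fst p)) (\<lambda>v. (\<omega> v, src_in (snd p) v)) act outp T (snd p)}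
      \<and> measure coin_space (S0 p) \<ge> 1 - \<delta>" by blast
  define S where "S i m = S0 (2 * 2 ^ i, m)" for i m :: nat
  have S: "S i m \<in> sets coin_space" "measure coin_space (S i m) \<ge> 1 - \<delta>"
    "\<And>\<omega>. \<omega> \<in> S i m \<Longrightarrow> broadcast_success False (K2_verts (2 * 2 ^ i)) (K2_adj (2 * 2 ^ i)) (\<lambda>v. (\<omega> v, src_in m v)) act outp T m"
    if "i < I" for i m
    using S0[of "(2 * 2 ^ i, m)"] k[OF that] unfolding S_def by auto
  have main: "exp (- (20 * real E / real I)) \<le> 2 * \<delta> + (real \<Delta>)\<^sup>2 * (1 / real M)" if M: "1 \<le> M" for M
  proof -
    define V where "V = {2..<M+2}"
    have V: "finite V" "card V = M" "V \<noteq> {}" using M by (auto simp: V_def)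
    define emb where "emb i g g' v = (if v < 2 then v else if v < 2 * 2 ^ i + 2 then join_tuples (2 ^ i) g g' (v - 2) else v + M)"
      for i :: nat and g g' and v :: nat
    define good where "good i = {(g, g'). g \<in> {..<2 ^ i} \<rightarrow>\<^sub>E V \<and> g' \<in> {..<2 ^ i} \<rightarrow>\<^sub>E V \<and>
        inj_on (join_tuples (2 ^ i) g g') {..<2 * 2 ^ i}}" for i :: nat
    \<comment> \<open>There are \<open>M ^ (2 * 2 ^ i)\<close> pairs of tuples at scale
      \<open>i\<close>, so each scale gets total weight at most 1 per message.\<close>
    define w where "w i = 1 / real M ^ (2 * 2 ^ i)" for i :: nat
    have finP: "finite ({..<2 ^ i :: nat} \<rightarrow>\<^sub>E V)" for i :: nat using V by (intro finite_PiE) auto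
    have sub: "good i \<subseteq> ({..<2 ^ i} \<rightarrow>\<^sub>E V) \<times> ({..<2 ^ i} \<rightarrow>\<^sub>E V)" for i by (auto simp: good_def)
    have fin: "finite (good i)" for i by (rule finite_subset[OF sub]) (use finP in auto)
    have card_good: "real (card (good i)) * w i \<le> 1" for i
    proof -
      have "card (good i) \<le> M ^ 2 ^ i * M ^ 2 ^ i"
        using card_mono[OF _ sub[of i]] finP V(2) by (simp add: card_cartesian_product card_funcsetE)
      also have "\<dots> = M ^ (2 * 2 ^ i)" by (simp add: mult_2 power_add)
      finally have "real (card (good i)) \<le> real M ^ (2 * 2 ^ i)" by (metis of_nat_le_iff of_nat_power)
      thus ?thesis using M by (simp add: w_def divide_le_eq)
    qed
    have emb: "inj (emb i g g')" if "(g, g') \<in> good i" for i g g'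
    proof -
      have "join_tuples (2 ^ i) g g' r \<in> V" if "r < 2 * 2 ^ i" for r
        using that \<open>(g, g') \<in> good i\<close> by (auto simp: good_def join_tuples_def PiE_def Pi_def)
      thus ?thesis unfolding emb_def using that
        by (intro inj_extend_leaf_assignment) (auto simp: good_def V_def image_subset_iff)
    qed
    \<comment> \<open>Both messages 0 and 1 take part, since the one that fools the second hub is
      known only after \<open>\<omega>\<close> is fixed. This costs the factor 2 in the
      result.\<close>
    define J where "J = (SIGMA i:{..<I}. {..<2::nat} \<times> good i)"
    have sumJ: "(\<Sum>p\<in>J. f p) = (\<Sum>i<I. \<Sum>y\<in>{..<2} \<times> good i. f (i, y))" for f :: "_ \<Rightarrow> real"
      unfolding J_def using fin by (simp add: sum.Sigma)
    have "\<exists>\<omega>. (\<Sum>p\<in>J. w (fst p) * of_bool (\<omega> \<circ> (\<lambda>(i, m, g, g'). emb i g g') p \<notin> S (fst p) (fst (snd p))))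
        \<le> \<delta> * (\<Sum>p\<in>J. w (fst p))"
      using fin S emb by (intro exists_coins_averaging) (auto simp: J_def w_def)
    then obtain \<omega> where "(\<Sum>p\<in>J. w (fst p) * of_bool (\<omega> \<circ> (\<lambda>(i, m, g, g'). emb i g g') p \<notin> S (fst p) (fst (snd p))))
        \<le> \<delta> * (\<Sum>p\<in>J. w (fst p))" by blast
    moreover have "(\<Sum>p\<in>J. w (fst p) * of_bool (\<omega> \<circ> (\<lambda>(i, m, g, g'). emb i g g') p \<notin> S (fst p) (fst (snd p))))
      = (\<Sum>i<I. \<Sum>m<2. \<Sum>d\<in>good i. w i * of_bool (\<omega> \<circ> emb i (fst d) (snd d) \<notin> S i m))"
      unfolding sumJ sum.cartesian_product by (intro sum.cong refl) (auto simp: case_prod_beta)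
    moreover have "(\<Sum>p\<in>J. w (fst p)) = (\<Sum>i<I. \<Sum>p\<in>{..<2::nat} \<times> good i. w i)"
      unfolding sumJ by simp
    moreover have "(\<Sum>i<I. \<Sum>p\<in>{..<2::nat} \<times> good i. w i) \<le> (\<Sum>i<I. 2)"
      using card_good by (intro sum_mono) (simp add: card_cartesian_product)
    ultimately have avg: "(\<Sum>i<I. \<Sum>m<2. \<Sum>d\<in>good i. w i * of_bool (\<omega> \<circ> emb i (fst d) (snd d) \<notin> S i m))
        \<le> \<delta> * (2 * real I)"
      using mult_left_mono[OF _ \<delta>] by fastforce
    define b where "b = (\<omega> 1, None :: nat option)"
    \<comment> \<open>The silent history of the second hub is free of the message, so at least one
      of two candidates is answered wrongly.\<close>
    obtain m :: nat where m: "m < 2" "m \<noteq> outp b (silent_history act b T)"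
    proof (cases "outp b (silent_history act b T) = 0")
      case True thus ?thesis using that[of 1] by simp
    next
      case False thus ?thesis using that[of 0] by simp
    qed
    define a where "a = (\<omega> 0, Some m)"
    define L where "L = silent_listening act a b T"
    define Y where "Y v = {t. twin_transmits False act a b (\<omega> v, None) t}" for v
    define U where "U i g = {j\<in>L. \<exists>r<2 ^ i. j \<in> Y (g r)}" for i :: nat and g :: "nat \<Rightarrow> nat"
    define q where "q j = real (card {v\<in>V. j \<notin> Y v}) / real (card V)" for j
    define H where "H i = (\<Sum>j\<in>L. binary_entropy (q j ^ 2 ^ i))" for i :: nat
    have "card L \<le> 2 * E"
      unfolding L_def silent_listening_def
      by (rule card_twin_listening_le[OF energy \<Delta> a_def b_def, of "\<omega> 2"]) (simp only: twin_run_no_cd simp_thms)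
    have fail: "\<omega> \<circ> emb i g g' \<notin> S i m" if i: "i < I" and g: "(g, g') \<in> good i" "U i g = U i g'" for i g g'
    proof
      let ?k = "2 * 2 ^ i :: nat"
      let ?l = "\<lambda>v. ((\<omega> \<circ> emb i g g') v, src_in m v)"
      assume "\<omega> \<circ> emb i g g' \<in> S i m"
      hence "broadcast_success False (K2_verts ?k) (K2_adj ?k) ?l act outp T m" by (rule S(3)[OF i])
      hence out: "outp (?l 1) (history False (K2_verts ?k) (K2_adj ?k) ?l act T 1) = m"
        by (rule broadcast_success_hub)
      have l: "?l 0 = a" "?l 1 = b" by (auto simp: emb_def a_def b_def)
      have leaf: "?l v = (\<omega> (join_tuples (2 ^ i) g g' (v - 2)), None)" if "v \<in> {2..?k+1}" for v
        using that by (auto simp: emb_def)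
      have no_single: "\<nexists>!v. v \<in> {2..?k+1} \<and> twin_transmits False act (?l 0) (?l 1) (?l v) t"
        if t: "t \<in> silent_listening act (?l 0) (?l 1) T" for t
      proof
        assume "\<exists>!v. v \<in> {2..?k+1} \<and> twin_transmits False act (?l 0) (?l 1) (?l v) t"
        then obtain v where v: "v \<in> {2..?k+1} \<and> twin_transmits False act (?l 0) (?l 1) (?l v) t"
          and uniq: "\<forall>u. u \<in> {2..?k+1} \<and> twin_transmits False act (?l 0) (?l 1) (?l u) t \<longrightarrow> u = v"
          by (rule ex1E)
        have L: "t \<in> L" using t unfolding l L_def .
        have tr: "twin_transmits False act (?l 0) (?l 1) (?l u) t = (t \<in> Y (join_tuples (2 ^ i) g g' (u - 2)))"
          if "u \<in> {2..?k+1}" for u unfolding leaf[OF that] l Y_def by simp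
        have v': "v \<in> {2..?k+1}" "t \<in> Y (join_tuples (2 ^ i) g g' (v - 2))" using v tr by auto
        have uniq': "r + 2 = v" if "r < ?k" "t \<in> Y (join_tuples (2 ^ i) g g' r)" for r
          using uniq[rule_format, of "r + 2"] tr[of "r + 2"] that by auto
        show False
        \<comment> \<open>A lone transmitter in one half puts \<open>t\<close> into the set of that
          half, hence into the set of the other half, which yields a second transmitter.\<close>
        proof (cases "v - 2 < 2 ^ i")
          case True
          hence "t \<in> U i g" using v' L by (auto simp: U_def join_tuples_def)
          then obtain r where r: "r < 2 ^ i" "t \<in> Y (g' r)" unfolding g(2) by (auto simp: U_def)
          hence "r + 2 ^ i + 2 = v" using uniq'[of "r + 2 ^ i"] by (simp add: join_tuples_def)
          thus False using True by simp
        next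
          case False
          hence "t \<in> Y (g' (v - 2 - 2 ^ i))" "v - 2 - 2 ^ i < 2 ^ i" using v' by (auto simp: join_tuples_def)
          hence "t \<in> U i g'" using L by (auto simp: U_def)
          then obtain r where r: "r < 2 ^ i" "t \<in> Y (g r)" unfolding g(2)[symmetric] by (auto simp: U_def)
          hence "r + 2 = v" using uniq'[of r] by (simp add: join_tuples_def)
          thus False using False r by simp
        qed
      qed
      have k1: "1 \<le> ?k" by simp
      have "history False (K2_verts ?k) (K2_adj ?k) ?l act T 1 = silent_history act (?l 1) T"
        using history_eq_silent(2)[where l = ?l, OF k1 no_single order_refl] by blast
      thus False using out m(2) unfolding l by simp
    qed
    have each: "exp (- H i) - (real \<Delta>)\<^sup>2 * (1 / real M) \<le> (\<Sum>d\<in>good i. w i * of_bool (\<omega> \<circ> emb i (fst d) (snd d) \<notin> S i m))"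
      if i: "i < I" for i
    proof -
      let ?C = "{(g, g'). g \<in> {..<2 ^ i} \<rightarrow>\<^sub>E V \<and> g' \<in> {..<2 ^ i} \<rightarrow>\<^sub>E V \<and>
         inj_on (join_tuples (2 ^ i) g g') {..<2 * 2 ^ i} \<and> U i g = U i g'}"
      have C: "?C \<subseteq> good i" by (auto simp: good_def)
      have "2 * real (2 ^ i) \<le> real \<Delta>" using k[OF i] by (metis atLeastAtMost_iff of_nat_le_iff of_nat_mult of_nat_numeral)
      hence "(2 * real (2 ^ i))\<^sup>2 \<le> (real \<Delta>)\<^sup>2" by (intro power_mono) auto
      hence "(2 * real (2 ^ i))\<^sup>2 / real M \<le> (real \<Delta>)\<^sup>2 * (1 / real M)" by (simp add: divide_right_mono)
      hence "exp (- H i) - (real \<Delta>)\<^sup>2 * (1 / real M) \<le> exp (- H i) - (2 * real (2 ^ i))\<^sup>2 / real M" by linarith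
      also have "\<dots> = w i * (real M ^ (2 * 2 ^ i) * (exp (- H i) - (2 * real (2 ^ i))\<^sup>2 / real M))"
        using M by (simp add: w_def)
      also have "\<dots> \<le> w i * real (card ?C)"
        using injective_collisions_ge[of V L "2 ^ i" Y] V
        unfolding H_def q_def U_def by (intro mult_left_mono) (auto simp: w_def L_def)
      also have "\<dots> = (\<Sum>d\<in>?C. w i * of_bool (\<omega> \<circ> emb i (fst d) (snd d) \<notin> S i m))"
      proof -
        have "(\<Sum>d\<in>?C. w i * of_bool (\<omega> \<circ> emb i (fst d) (snd d) \<notin> S i m)) = (\<Sum>d\<in>?C. w i)"
        proof (rule sum.cong)
          fix d assume "d \<in> ?C"
          then obtain g g' where "d = (g, g')" "(g, g') \<in> good i" "U i g = U i g'" using C by blast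
          thus "w i * of_bool (\<omega> \<circ> emb i (fst d) (snd d) \<notin> S i m) = w i" using fail[OF i] by simp
        qed simp
        thus ?thesis by simp
      qed
      also have "\<dots> \<le> (\<Sum>d\<in>good i. w i * of_bool (\<omega> \<circ> emb i (fst d) (snd d) \<notin> S i m))"
        using fin C by (intro sum_mono2) (auto simp: w_def)
      finally show ?thesis .
    qed
    have q01: "0 \<le> q j" "q j \<le> 1" for j
      using M card_mono[OF V(1), of "{v\<in>V. j \<notin> Y v}"] by (auto simp: q_def V(2) divide_le_eq)
    have "(\<Sum>i<I. H i) = (\<Sum>j\<in>L. \<Sum>i<I. binary_entropy (q j ^ 2 ^ i))" unfolding H_def by (rule sum.swap)
    also have "\<dots> \<le> (\<Sum>j\<in>L. 10)" by (intro sum_mono sum_binary_entropy_dyadic_le q01)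
    also have "\<dots> \<le> 20 * real E" using \<open>card L \<le> 2 * E\<close> by simp
    finally have H: "(\<Sum>i<I. H i) \<le> 20 * real E" .
    have "real I * exp (- (20 * real E / real I)) \<le> real I * exp ((\<Sum>i<I. - H i) / real I)"
      using H I(1) by (auto simp: sum_negf divide_right_mono)
    also have "\<dots> \<le> (\<Sum>i<I. exp (- H i))"
    proof -
      have "{..<I} \<noteq> {}" using I(1) by (auto simp: lessThan_empty_iff)
      thus ?thesis using card_mult_exp_mean_le_sum_exp[of "{..<I}" "\<lambda>i. - H i"] by simp
    qed
    also have "\<dots> = (\<Sum>i<I. exp (- H i) - (real \<Delta>)\<^sup>2 * (1 / real M)) + real I * ((real \<Delta>)\<^sup>2 * (1 / real M))"
      by (simp add: sum_subtractf)
    also have "(\<Sum>i<I. exp (- H i) - (real \<Delta>)\<^sup>2 * (1 / real M)) \<le>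
        (\<Sum>i<I. \<Sum>d\<in>good i. w i * of_bool (\<omega> \<circ> emb i (fst d) (snd d) \<notin> S i m))"
      using each by (intro sum_mono) auto
    also have "\<dots> \<le> (\<Sum>i<I. \<Sum>m<2. \<Sum>d\<in>good i. w i * of_bool (\<omega> \<circ> emb i (fst d) (snd d) \<notin> S i m))"
    proof (rule sum_mono)
      fix i
      show "(\<Sum>d\<in>good i. w i * of_bool (\<omega> \<circ> emb i (fst d) (snd d) \<notin> S i m))
        \<le> (\<Sum>m<2. \<Sum>d\<in>good i. w i * of_bool (\<omega> \<circ> emb i (fst d) (snd d) \<notin> S i m))"
        using m(1) by (intro member_le_sum) (auto intro!: sum_nonneg simp: w_def)
    qed
    also note avg
    finally have "real I * exp (- (20 * real E / real I)) \<le> real I * (2 * \<delta> + (real \<Delta>)\<^sup>2 * (1 / real M))"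
      by (simp add: algebra_simps)
    thus ?thesis using I(1) by simp
  qed
  have "(\<lambda>M. 2 * \<delta> + (real \<Delta>)\<^sup>2 * (1 / real M)) \<longlonglongrightarrow> 2 * \<delta> + (real \<Delta>)\<^sup>2 * 0"
    by (intro tendsto_intros lim_1_over_n)
  hence "(\<lambda>M. 2 * \<delta> + (real \<Delta>)\<^sup>2 * (1 / real M)) \<longlonglongrightarrow> 2 * \<delta>" by simp
  hence "exp (- (20 * real E / real I)) \<le> 2 * \<delta>"
    by (rule LIMSEQ_le_const) (use main in blast)
  thus ?thesis by (simp add: \<delta>_def)
qed

section \<open>Bounds in logarithmic form\<close>

text \<open>\<open>I\<close> is the binary logarithm of \<open>\<Delta>\<close> rounded down. The
  constant is 20 from the entropy bound, times 2 for absorbing \<open>ln 2\<close> since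
  \<open>n \<ge> 4\<close>, times 2 for \<open>ln \<Delta> \<le> 2 * I\<close>.\<close>

lemma no_cd_energy_ln:
  fixes act :: "(nat \<Rightarrow> bool) \<times> nat option \<Rightarrow> 'msg feedback list \<Rightarrow> 'msg action"
  assumes "1 \<le> c" "2 \<le> \<Delta>" "\<Delta> + 2 \<le> n"
    and whp: "rand_K2_whp False n c \<Delta> act outp T"
    and energy: "rand_K2_energy False \<Delta> act T E"
  shows "1 / 80 * ln (real \<Delta>) * ln (real n) \<le> real E"
proof -
  obtain I where I: "2 ^ I \<le> \<Delta>" "\<Delta> < 2 ^ (I + 1)" using ex_power_ivl1[of 2 \<Delta>] assms(2) by auto
  have I1: "1 \<le> I" using I(2) assms(2) by (cases I) auto
  have n: "4 \<le> real n" using assms(2,3) by simp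
  have "exp (- (20 * real E / real I)) \<le> 2 / (real n powr c)"
    by (rule no_cd_energy_bound[OF I1 I(1) whp energy])
  \<comment> \<open>Every \<open>c \<ge> 1\<close> reduces to \<open>c = 1\<close>, so the constant
    does not depend on \<open>c\<close>.\<close>
  also have "\<dots> \<le> 2 / (real n powr 1)"
    using n assms(1) by (intro divide_left_mono powr_mono) auto
  finally have "exp (- (20 * real E / real I)) \<le> 2 / real n" using n by simp
  hence "ln (exp (- (20 * real E / real I))) \<le> ln (2 / real n)" using n by (subst ln_le_cancel_iff) auto
  hence 1: "ln (real n) - ln 2 \<le> 20 * real E / real I" using n by (simp add: ln_div)
  have "2 * ln 2 = ln (4::real)" using ln_realpow[of 2 2] by simp
  also have "\<dots> \<le> ln (real n)" using n by simp
  finally have "ln (real n) / 2 \<le> 20 * real E / real I" using 1 by simp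
  hence 2: "real I * ln (real n) \<le> 40 * real E" using I1 by (simp add: field_simps)
  have "real \<Delta> \<le> real (2 ^ (I + 1))" using I(2) by (simp only: of_nat_le_iff less_imp_le)
  hence "ln (real \<Delta>) \<le> ln (2 ^ (I + 1))" using assms(2) by (subst ln_le_cancel_iff) auto
  also have "\<dots> = real (I + 1) * ln 2" by (rule ln_realpow)
  also have "\<dots> \<le> real (I + 1) * 1" using ln_le_minus_one[of "2::real"] by (intro mult_left_mono) auto
  finally have "ln (real \<Delta>) \<le> 2 * real I" using I1 by simp
  hence "ln (real \<Delta>) * ln (real n) \<le> 2 * real I * ln (real n)" using n by (intro mult_right_mono) auto
  thus ?thesis using 2 by simp
qed

lemma cd_energy_ln:
  fixes act :: "(nat \<Rightarrow> bool) \<times> nat option \<Rightarrow> 'msg feedback list \<Rightarrow> 'msg action"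
  assumes "1 \<le> c" "2 \<le> \<Delta>" "\<Delta> + 2 \<le> n"
    and whp: "rand_K2_whp True n c \<Delta> act outp T"
    and energy: "rand_K2_energy True \<Delta> act T E"
  shows "1 / 4 * ln (real n) \<le> real E"
proof -
  have n: "4 \<le> real n" using assms(2,3) by simp
  have "1 / 2 ^ (4 * E) \<le> 1 / (real n powr c)" by (rule cd_energy_bound[OF assms(2) whp energy])
  also have "\<dots> \<le> 1 / (real n powr 1)" using n assms(1) by (intro divide_left_mono powr_mono) auto
  finally have "real n \<le> 2 ^ (4 * E)" using n by (simp add: field_simps)
  hence "ln (real n) \<le> ln (2 ^ (4 * E))" using n by simp
  also have "\<dots> = real (4 * E) * ln 2" by (rule ln_realpow)
  also have "\<dots> \<le> real (4 * E) * 1" using ln_le_minus_one[of "2::real"] by (intro mult_left_mono) auto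
  finally show ?thesis by simp
qed

theorem theorem2:
  shows
  "(\<exists>C>0. \<forall>N \<Delta> (act :: nat \<times> nat option \<Rightarrow> 'msg feedback list \<Rightarrow> 'msg action) outp T E.
       1 \<le> \<Delta> \<and> \<Delta> + 2 \<le> N \<and> det_K2_correct False N \<Delta> act outp T \<and> det_K2_energy False N \<Delta> act T E
       \<longrightarrow> real E \<ge> C * real \<Delta>)
   \<and> (\<forall>c::real. c \<ge> 1 \<longrightarrow> (\<exists>C>0. \<forall>n \<Delta> (act :: (nat \<Rightarrow> bool) \<times> nat option \<Rightarrow> 'msg feedback list \<Rightarrow> 'msg action) outp T E.
       2 \<le> \<Delta> \<and> \<Delta> + 2 \<le> n \<and> rand_K2_whp False n c \<Delta> act outp T \<and> rand_K2_energy False \<Delta> act T E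
       \<longrightarrow> real E \<ge> C * ln (real \<Delta>) * ln (real n)))
   \<and> (\<forall>c::real. c \<ge> 1 \<longrightarrow> (\<exists>C>0. \<forall>n \<Delta> (act :: (nat \<Rightarrow> bool) \<times> nat option \<Rightarrow> 'msg feedback list \<Rightarrow> 'msg action) outp T E.
       2 \<le> \<Delta> \<and> \<Delta> + 2 \<le> n \<and> rand_K2_whp True n c \<Delta> act outp T \<and> rand_K2_energy True \<Delta> act T E
       \<longrightarrow> real E \<ge> C * ln (real n)))"
proof (intro conjI allI impI)
  show "\<exists>C>0. \<forall>N \<Delta> (act :: nat \<times> nat option \<Rightarrow> 'msg feedback list \<Rightarrow> 'msg action) outp T E.
       1 \<le> \<Delta> \<and> \<Delta> + 2 \<le> N \<and> det_K2_correct False N \<Delta> act outp T \<and> det_K2_energy False N \<Delta> act T E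
       \<longrightarrow> real E \<ge> C * real \<Delta>"
  proof (intro exI[of _ "1/2"] conjI allI impI; (elim conjE)?)
    fix N \<Delta> T E and act :: "nat \<times> nat option \<Rightarrow> 'msg feedback list \<Rightarrow> 'msg action" and outp
    assume "1 \<le> \<Delta>" "\<Delta> + 2 \<le> N" "det_K2_correct False N \<Delta> act outp T" "det_K2_energy False N \<Delta> act T E"
    hence "\<Delta> \<le> 2 * E" by (rule deterministic_energy_bound)
    thus "1 / 2 * real \<Delta> \<le> real E" by linarith
  qed simp
next
  fix c :: real assume "1 \<le> c"
  thus "\<exists>C>0. \<forall>n \<Delta> (act :: (nat \<Rightarrow> bool) \<times> nat option \<Rightarrow> 'msg feedback list \<Rightarrow> 'msg action) outp T E.
       2 \<le> \<Delta> \<and> \<Delta> + 2 \<le> n \<and> rand_K2_whp False n c \<Delta> act outp T \<and> rand_K2_energy False \<Delta> act T E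
       \<longrightarrow> real E \<ge> C * ln (real \<Delta>) * ln (real n)"
    by (intro exI[of _ "1/80"] conjI allI impI; (elim conjE)?) (simp, rule no_cd_energy_ln)
next
  fix c :: real assume "1 \<le> c"
  thus "\<exists>C>0. \<forall>n \<Delta> (act :: (nat \<Rightarrow> bool) \<times> nat option \<Rightarrow> 'msg feedback list \<Rightarrow> 'msg action) outp T E.
       2 \<le> \<Delta> \<and> \<Delta> + 2 \<le> n \<and> rand_K2_whp True n c \<Delta> act outp T \<and> rand_K2_energy True \<Delta> act T E
       \<longrightarrow> real E \<ge> C * ln (real n)"
    by (intro exI[of _ "1/4"] conjI allI impI; (elim conjE)?) (simp, rule cd_energy_ln)
qed

end
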